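(* Let $m\ge2$, let $H$ be a complex Hilbert space, and let $E$ be a POVM on $\Omega_m=\{0,\dots,m-1\}^{\mathbb N}$ with values in $B(H)$. Let $H_w$, $K_n$, $J_n:K_n\to K_{n+1}$, $K_E$ and $U_n:K_n\to K_E$ be the range spaces, level spaces, connecting isometries, direct limit Hilbert space and canonical isometries attached to $E$. For a finite word $w$ and any $n\ge|w|$, let $P_w^{(n)}$ be the orthogonal projection of $K_n$ onto $$\bigoplus_{|u|=n,\ u\succeq w}H_u,$$ where $u\succeq w$ means that $u$ extends $w$. Then $$P_w^{(n+1)}J_n=J_nP_w^{(n)},\qquad n\ge|w|.$$ Hence there are projections $P_w\in B(K_E)$ such that $$P_wU_n=U_nP_w^{(n)},\qquad n\ge|w|.$$ Moreover, there is a unique projection-valued measure $P:\mathcal B(\Omega_m)\to B(K_E)$ such that $P([w])=P_w$ for every finite word $w$.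
   Context: $\Omega_m$ carries its product Borel $\sigma$-algebra $\mathcal B(\Omega_m)$. For a finite word $w=w_1\cdots w_n$ in $\{0,\dots,m-1\}$, $|w|=n$ and $[w]=\{x\in\Omega_m:x_1=w_1,\dots,x_n=w_n\}$; the empty word is $\varnothing$, and $[\varnothing]=\Omega_m$; $wj$ is $w$ with the letter $j$ appended. A POVM on $\Omega_m$ with values in $B(H)$ is a map $E:\mathcal B(\Omega_m)\to B(H)_+$ that is countably additive in the weak operator topology and satisfies $E(\Omega_m)=I$; it is a projection-valued measure (PVM) if all its values are orthogonal projections. Put $E_w=E([w])$ and $H_w=\overline{\operatorname{ran}}(E_w^{1/2})$. For $0\le j\le m-1$, the edge contraction $C_{wj}:H_w\to H_{wj}$ is the unique contraction with $C_{wj}E_w^{1/2}h=E_{wj}^{1/2}h$ for all $h\in H$. Set $K_n=\bigoplus_{|w|=n}H_w$ (so $K_0=H$), and let $J_n:K_n\to K_{n+1}$ be given by $(J_nx)_{wj}=C_{wj}x_w$ for $|w|=n$, $0\le j\le m-1$; each $J_n$ is an isometry. $K_E$ is the Hilbert space direct limit of $K_0\xrightarrow{J_0}K_1\xrightarrow{J_1}K_2\to\cdots$, with canonical isometries $U_n:K_n\to K_E$ satisfying $U_{n+1}J_n=U_n$ and $K_E=\overline{\bigcup_{n\ge0}U_nK_n}$. *)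

theory Defs
  imports "HOL-Analysis.Analysis" "HOL-Library.Sublist"
begin

section \<open>Complex Hilbert spaces\<close>

class scaleC =
  fixes scaleC :: "complex \<Rightarrow> 'a \<Rightarrow> 'a"  (infixr \<open>*\<^sub>C\<close> 75)

text \<open>The complex inner product is conjugate-linear in its first argument. Norm and topology are
  those of the underlying real inner product space, whose inner product is the real part of the
  complex one.\<close>

class complex_inner = real_inner + scaleC +
  fixes cinner :: "'a \<Rightarrow> 'a \<Rightarrow> complex"
  assumes scaleC_add_right: "a *\<^sub>C (x + y) = a *\<^sub>C x + a *\<^sub>C y"
    and scaleC_add_left: "(a + b) *\<^sub>C x = a *\<^sub>C x + b *\<^sub>C x"
    and scaleC_scaleC: "a *\<^sub>C (b *\<^sub>C x) = (a * b) *\<^sub>C x"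
    and scaleC_of_real: "complex_of_real r *\<^sub>C x = r *\<^sub>R x"
    and cinner_commute: "cinner x y = cnj (cinner y x)"
    and cinner_add_left: "cinner (x + y) z = cinner x z + cinner y z"
    and cinner_scaleC_left: "cinner (a *\<^sub>C x) y = cnj a * cinner x y"
    and inner_eq_Re_cinner: "inner x y = Re (cinner x y)"

class chilbert_space = complex_inner + complete_space

instantiation complex :: chilbert_space
begin

definition scaleC_complex :: "complex \<Rightarrow> complex \<Rightarrow> complex"
  where "scaleC_complex a x = a * x"

definition cinner_complex :: "complex \<Rightarrow> complex \<Rightarrow> complex"
  where "cinner_complex x y = cnj x * y"

instance
  by standard
    (auto simp: scaleC_complex_def cinner_complex_def algebra_simps scaleR_conv_of_real
      inner_complex_def)

end

section \<open>Bounded operators\<close>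

definition bounded_clinear :: "('a::complex_inner \<Rightarrow> 'b::complex_inner) \<Rightarrow> bool"
  where "bounded_clinear A \<longleftrightarrow> bounded_linear A \<and> (\<forall>c x. A (c *\<^sub>C x) = c *\<^sub>C A x)"

definition positive_op :: "('a::complex_inner \<Rightarrow> 'a) \<Rightarrow> bool"
  where "positive_op A \<longleftrightarrow> bounded_clinear A \<and> (\<forall>x. cinner x (A x) \<in> \<real>\<^sub>\<ge>\<^sub>0)"

definition sqrt_op :: "('a::complex_inner \<Rightarrow> 'a) \<Rightarrow> 'a \<Rightarrow> 'a"
  where "sqrt_op A = (THE B. positive_op B \<and> B \<circ> B = A)"

definition orth_projection :: "('a::complex_inner \<Rightarrow> 'a) \<Rightarrow> bool"
  where "orth_projection P \<longleftrightarrow>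
    bounded_clinear P \<and> P \<circ> P = P \<and> (\<forall>x y. cinner (P x) y = cinner x (P y))"

section \<open>Words, cylinders and operator-valued measures\<close>

definition Omega :: "nat \<Rightarrow> (nat \<Rightarrow> nat) measure"
  where "Omega m = PiM UNIV (\<lambda>_. count_space {..<m})"

definition words :: "nat \<Rightarrow> nat \<Rightarrow> nat list set"
  where "words m n = {w \<in> lists {..<m}. length w = n}"

text \<open>Coordinates of sequences are counted from \<open>0\<close>.\<close>

definition cyl :: "nat \<Rightarrow> nat list \<Rightarrow> (nat \<Rightarrow> nat) set"
  where "cyl m w = {x \<in> space (Omega m). \<forall>i<length w. x i = w ! i}"

definition povm :: "nat \<Rightarrow> ((nat \<Rightarrow> nat) set \<Rightarrow> 'a::chilbert_space \<Rightarrow> 'a) \<Rightarrow> bool"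
  where "povm m E \<longleftrightarrow>
    (\<forall>A \<in> sets (Omega m). positive_op (E A)) \<and>
    (\<forall>A :: nat \<Rightarrow> (nat \<Rightarrow> nat) set. range A \<subseteq> sets (Omega m) \<longrightarrow> disjoint_family A \<longrightarrow>
      (\<forall>x y. (\<lambda>i. cinner x (E (A i) y)) sums cinner x (E (\<Union>i. A i) y))) \<and>
    E (space (Omega m)) = id"

definition pvm :: "nat \<Rightarrow> ((nat \<Rightarrow> nat) set \<Rightarrow> 'a::chilbert_space \<Rightarrow> 'a) \<Rightarrow> bool"
  where "pvm m E \<longleftrightarrow> povm m E \<and> (\<forall>A \<in> sets (Omega m). orth_projection (E A))"

section \<open>The tower of level spaces\<close>

definition range_space ::
    "nat \<Rightarrow> ((nat \<Rightarrow> nat) set \<Rightarrow> 'h::chilbert_space \<Rightarrow> 'h) \<Rightarrow> nat list \<Rightarrow> 'h set"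
  where "range_space m E w = closure (range (sqrt_op (E (cyl m w))))"

text \<open>Maps with domain \<open>range_space m E w\<close> are taken to be \<open>undefined\<close> outside it, so that the edge
  contraction is unique as a HOL function.\<close>

definition edge_contraction ::
    "nat \<Rightarrow> ((nat \<Rightarrow> nat) set \<Rightarrow> 'h::chilbert_space \<Rightarrow> 'h) \<Rightarrow> nat list \<Rightarrow> nat \<Rightarrow> 'h \<Rightarrow> 'h"
  where "edge_contraction m E w j = (THE C.
    C \<in> range_space m E w \<rightarrow>\<^sub>E range_space m E (w @ [j]) \<and>
    (\<forall>x \<in> range_space m E w. \<forall>y \<in> range_space m E w. C (x + y) = C x + C y) \<and>
    (\<forall>c. \<forall>x \<in> range_space m E w. C (c *\<^sub>C x) = c *\<^sub>C C x) \<and>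
    (\<forall>x \<in> range_space m E w. norm (C x) \<le> norm x) \<and>
    (\<forall>h. C (sqrt_op (E (cyl m w)) h) = sqrt_op (E (cyl m (w @ [j]))) h))"

text \<open>The elements of the \<open>n\<close>-th level space are families indexed by the words of length \<open>n\<close>,
  extended by \<open>0\<close> to all lists; the vector space operations are pointwise.\<close>

definition level ::
    "nat \<Rightarrow> ((nat \<Rightarrow> nat) set \<Rightarrow> 'h::chilbert_space \<Rightarrow> 'h) \<Rightarrow> nat \<Rightarrow> (nat list \<Rightarrow> 'h) set"
  where "level m E n =
    {x. (\<forall>w \<in> words m n. x w \<in> range_space m E w) \<and> (\<forall>w. w \<notin> words m n \<longrightarrow> x w = 0)}"

definition level_inner ::
    "nat \<Rightarrow> nat \<Rightarrow> (nat list \<Rightarrow> 'h::chilbert_space) \<Rightarrow> (nat list \<Rightarrow> 'h) \<Rightarrow> complex"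
  where "level_inner m n x y = (\<Sum>w \<in> words m n. cinner (x w) (y w))"

definition level_map ::
    "nat \<Rightarrow> ((nat \<Rightarrow> nat) set \<Rightarrow> 'h::chilbert_space \<Rightarrow> 'h) \<Rightarrow> nat \<Rightarrow>
      (nat list \<Rightarrow> 'h) \<Rightarrow> nat list \<Rightarrow> 'h"
  where "level_map m E n x = (\<lambda>u.
    if u \<in> words m (Suc n) then edge_contraction m E (butlast u) (last u) (x (butlast u)) else 0)"

text \<open>The sum of the summands of the \<open>n\<close>-th level space over the words extending \<open>w\<close>.\<close>

definition sublevel ::
    "nat \<Rightarrow> ((nat \<Rightarrow> nat) set \<Rightarrow> 'h::chilbert_space \<Rightarrow> 'h) \<Rightarrow> nat \<Rightarrow> nat list \<Rightarrow>
      (nat list \<Rightarrow> 'h) set"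
  where "sublevel m E n w = {x \<in> level m E n. \<forall>u \<in> words m n. \<not> prefix w u \<longrightarrow> x u = 0}"

definition level_proj ::
    "nat \<Rightarrow> ((nat \<Rightarrow> nat) set \<Rightarrow> 'h::chilbert_space \<Rightarrow> 'h) \<Rightarrow> nat \<Rightarrow> nat list \<Rightarrow>
      (nat list \<Rightarrow> 'h) \<Rightarrow> nat list \<Rightarrow> 'h"
  where "level_proj m E n w x = (THE y. y \<in> sublevel m E n w \<and>
    (\<forall>z \<in> sublevel m E n w. level_inner m n (\<lambda>u. x u - y u) z = 0))"

text \<open>The Hilbert space direct limit is determined up to unitary equivalence by the following
  properties of the canonical isometries \<open>U n\<close> into it; here the limit is the whole type \<open>'k\<close>.\<close>

definition direct_limit ::
    "nat \<Rightarrow> ((nat \<Rightarrow> nat) set \<Rightarrow> 'h::chilbert_space \<Rightarrow> 'h) \<Rightarrow>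
      (nat \<Rightarrow> (nat list \<Rightarrow> 'h) \<Rightarrow> 'k::chilbert_space) \<Rightarrow> bool"
  where "direct_limit m E U \<longleftrightarrow>
    (\<forall>n. \<forall>x \<in> level m E n. \<forall>y \<in> level m E n. U n (\<lambda>w. x w + y w) = U n x + U n y) \<and>
    (\<forall>n c. \<forall>x \<in> level m E n. U n (\<lambda>w. c *\<^sub>C x w) = c *\<^sub>C U n x) \<and>
    (\<forall>n. \<forall>x \<in> level m E n. \<forall>y \<in> level m E n. cinner (U n x) (U n y) = level_inner m n x y) \<and>
    (\<forall>n. \<forall>x \<in> level m E n. U (Suc n) (level_map m E n x) = U n x) \<and>
    closure (\<Union>n. U n ` level m E n) = UNIV"

end

theory Submission
  imports Defs
begin

text \<open>
  The measure to be constructed is the one of Naimark's dilation of \<open>E\<close>, realized on the direct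
  limit. Write \<open>S w\<close> for the positive square root of \<open>E (cyl m w)\<close>. Since \<open>S (w @ [j])\<close> is dominated
  by \<open>S w\<close>, the edge contractions exist (\<open>contraction_ex1\<close>), and since the connecting maps only
  append a letter to each word, they commute with the restriction of a family to the words
  extending \<open>w\<close>, which is the level projection (\<open>level_proj_eq\<close>, \<open>restrict_ext_level_map\<close>).
  The restrictions at all levels therefore fit together to a densely defined, symmetric and
  idempotent linear relation on the limit space, whose closure is the graph of an orthogonal
  projection (\<open>orth_projection_graph\<close>, \<open>cylinder_projection_ex\<close>).

  For the measure, consider the dense set of vectors \<open>\<xi> = limit_vector n h\<close>, the images in the limit
  space of the families with components \<open>S u (h u)\<close> at the words \<open>u\<close> of length \<open>n\<close>. The
  cylinder projection of \<open>w\<close> has at \<open>\<xi>\<close> the quadratic form \<open>mass n h (cyl m w)\<close>, where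
  \<open>mass n h A\<close> is the sum over these \<open>u\<close> of \<open>inner (h u) (E (A \<inter> cyl m u) (h u))\<close>. The right
  side makes sense for every measurable \<open>A\<close> and is countably additive in \<open>A\<close>, because \<open>E\<close> is. A
  projection is determined by its quadratic form on a dense set, so it remains to see that for
  every measurable \<open>A\<close> some projection \<open>Q\<close> has the form \<open>mass n h A\<close> at all \<open>\<xi>\<close>. The sets \<open>A\<close> for
  which this holds contain the cylinder sets and are closed under complements (take \<open>x - Q x\<close>) and
  under countable disjoint unions: the form of a finite sum of the projections involved stays below
  \<open>inner \<xi> \<xi>\<close>, which makes them mutually orthogonal and their series strongly convergent to a
  projection (\<open>orth_projection_series\<close>). By the \<open>\<pi>\<close>-\<open>\<lambda>\<close> theorem every measurable set has such a
  projection, and no extension theorem for scalar measures is needed. The same theorem gives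
  uniqueness (\<open>povm_eqI\<close>).

  The existence and uniqueness of positive square roots is proved from the Taylor series of the
  square root of \<open>1 - z\<close>, whose coefficients are absolutely summable.
\<close>

section \<open>Operators on complex Hilbert spaces\<close>

instance chilbert_space \<subseteq> banach ..

lemma cinner_conv_inner: "cinner x y = Complex (inner x y) (inner (\<i> *\<^sub>C x) y)"
  by (rule complex_eqI) (simp_all add: inner_eq_Re_cinner cinner_scaleC_left)

lemma cinner_scaleC_right: "cinner x (c *\<^sub>C y) = c * cinner x y"
  by (metis cinner_commute cinner_scaleC_left complex_cnj_cnj complex_cnj_mult)

lemma cinner_zero_left: "cinner 0 y = 0"
  using cinner_add_left[of 0 0 y] by simp

lemma cinner_diff_left: "cinner (x - y) z = cinner x z - cinner y z"
  by (metis add_diff_cancel cinner_add_left diff_add_cancel)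

lemma scaleC_zero_right [simp]: "c *\<^sub>C (0::'a::complex_inner) = 0"
  using scaleC_add_right[of c 0 0] by simp

lemma minus_one_scaleC: "(- 1) *\<^sub>C x = - (x::'a::complex_inner)"
  using scaleC_of_real[of "- 1" x] by simp

lemma norm_scaleC: "norm (c *\<^sub>C (x::'a::complex_inner)) = cmod c * norm x"
proof -
  have "cinner (c *\<^sub>C x) (c *\<^sub>C x) = of_real ((cmod c)\<^sup>2) * cinner x x"
    by (simp add: cinner_scaleC_left cinner_scaleC_right complex_norm_square mult.commute del: of_real_power)
  then have "(norm (c *\<^sub>C x))\<^sup>2 = (cmod c * norm x)\<^sup>2"
    by (simp add: power2_norm_eq_inner inner_eq_Re_cinner power_mult_distrib)
  then show ?thesis by (simp add: power2_eq_iff_nonneg)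
qed

lemma bounded_linear_scaleC: "bounded_linear (\<lambda>x::'a::complex_inner. c *\<^sub>C x)"
proof (rule bounded_linear_intro)
  show "c *\<^sub>C (r *\<^sub>R x) = r *\<^sub>R c *\<^sub>C x" for r and x :: 'a
    by (metis scaleC_of_real scaleC_scaleC mult.commute)
  show "norm (c *\<^sub>C x) \<le> norm x * cmod c" for x :: 'a
    by (simp add: norm_scaleC mult.commute)
qed (simp add: scaleC_add_right)

lemmas tendsto_scaleC = bounded_linear.tendsto[OF bounded_linear_scaleC]

lemma scaleC_diff_right: "c *\<^sub>C (x - y) = c *\<^sub>C x - c *\<^sub>C (y::'a::complex_inner)"
  by (rule linear_diff[OF bounded_linear.linear[OF bounded_linear_scaleC]])

lemma scaleC_scaleR_commute: "c *\<^sub>C (r *\<^sub>R x) = r *\<^sub>R c *\<^sub>C (x::'a::complex_inner)"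
  by (metis scaleC_of_real scaleC_scaleC mult.commute)

lemma sums_cinnerI:
  assumes "\<And>x. (\<lambda>i. inner x (f i)) sums inner x (s::'a::complex_inner)"
  shows "(\<lambda>i. cinner x (f i)) sums cinner x s"
  unfolding cinner_conv_inner by (auto simp: sums_complex_iff assms)

lemma bounded_clinearI:
  assumes "\<And>x y. A (x + y) = A x + A y" "\<And>c x. A (c *\<^sub>C x) = c *\<^sub>C A x"
    "\<And>x. norm (A x) \<le> norm x * K"
  shows "bounded_clinear A"
proof -
  have "bounded_linear A"
  proof (rule bounded_linear_intro[where K = K])
    show "A (r *\<^sub>R x) = r *\<^sub>R A x" for r x
      using assms(2)[of "complex_of_real r" x] by (simp add: scaleC_of_real)
  qed (use assms in auto)
  then show ?thesis using assms(2) by (simp add: bounded_clinear_def)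
qed

lemma
  assumes "bounded_clinear A"
  shows bounded_clinear_linear: "bounded_linear A"
    and bounded_clinear_add: "A (x + y) = A x + A y"
    and bounded_clinear_diff: "A (x - y) = A x - A y"
    and bounded_clinear_zero: "A 0 = 0"
    and bounded_clinear_scaleR: "A (r *\<^sub>R x) = r *\<^sub>R A x"
    and bounded_clinear_scaleC: "A (c *\<^sub>C x) = c *\<^sub>C A x"
proof -
  show lin: "bounded_linear A" and "A (c *\<^sub>C x) = c *\<^sub>C A x"
    using assms by (auto simp: bounded_clinear_def)
  from bounded_linear.linear[OF lin]
  show "A (x + y) = A x + A y" "A (x - y) = A x - A y" "A 0 = 0" "A (r *\<^sub>R x) = r *\<^sub>R A x"
    by (auto simp: linear_add linear_diff linear_0 linear_scale)
qed

lemma bounded_clinear_id: "bounded_clinear (\<lambda>x. x)"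
  by (simp add: bounded_clinear_def)

lemma bounded_clinear_subtract:
  assumes "bounded_clinear A" "bounded_clinear B"
  shows "bounded_clinear (\<lambda>x. A x - B x)"
  using assms by (simp add: bounded_clinear_def bounded_linear_sub scaleC_diff_right)

lemma bounded_clinear_scale:
  assumes "bounded_clinear A"
  shows "bounded_clinear (\<lambda>x. r *\<^sub>R A x)"
  using assms unfolding bounded_clinear_def
  by (auto intro: bounded_linear_const_scaleR simp: scaleC_scaleR_commute)

lemma bounded_clinear_compose:
  assumes "bounded_clinear A" "bounded_clinear B"
  shows "bounded_clinear (\<lambda>x. A (B x))"
  using assms by (simp add: bounded_clinear_def bounded_linear_compose)

lemma bounded_clinear_funpow:
  fixes A :: "'a::complex_inner \<Rightarrow> 'a"
  assumes "bounded_clinear A" shows "bounded_clinear (A ^^ k)"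
proof (induction k)
  case 0
  show ?case by (simp add: id_def bounded_clinear_id)
next
  case (Suc k)
  from bounded_clinear_compose[OF assms this] show ?case by (simp add: comp_def)
qed

text \<open>Symmetry with respect to the real inner product; for complex linear operators it amounts to
  self-adjointness, and most of the operator theory below only needs the real inner product.\<close>

definition symmetric_op :: "('a::complex_inner \<Rightarrow> 'a) \<Rightarrow> bool"
  where "symmetric_op A \<longleftrightarrow> (\<forall>x y. inner (A x) y = inner x (A y))"

lemma symmetric_opD: "symmetric_op A \<Longrightarrow> inner (A x) y = inner x (A y)"
  by (simp add: symmetric_op_def)

lemma symmetric_op_cinner:
  assumes "bounded_clinear A" "symmetric_op A"
  shows "cinner (A x) y = cinner x (A y)"
  using symmetric_opD[OF assms(2)]
  by (simp add: cinner_conv_inner flip: bounded_clinear_scaleC[OF assms(1)])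

lemma orth_projection_iff:
  "orth_projection P \<longleftrightarrow> bounded_clinear P \<and> symmetric_op P \<and> (\<forall>x. P (P x) = P x)"
proof -
  have "symmetric_op P" if "\<forall>x y. cinner (P x) y = cinner x (P y)"
    using that by (simp add: symmetric_op_def inner_eq_Re_cinner)
  then show ?thesis
    using symmetric_op_cinner[of P] by (auto simp: orth_projection_def fun_eq_iff)
qed

lemma positive_op_iff:
  "positive_op A \<longleftrightarrow> bounded_clinear A \<and> symmetric_op A \<and> (\<forall>x. 0 \<le> inner x (A x))"
proof (intro iffI conjI allI)
  assume pos: "positive_op A"
  then show lin: "bounded_clinear A" by (simp add: positive_op_def)
  have real: "Im (cinner x (A x)) = 0" and nonneg: "0 \<le> Re (cinner x (A x))" for x
    using pos by (auto simp: positive_op_def complex_nonneg_Reals_iff)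
  show "0 \<le> inner x (A x)" for x using nonneg by (simp add: inner_eq_Re_cinner)
  show "symmetric_op A" unfolding symmetric_op_def
  proof (intro allI)
    fix x y
    \<comment> \<open>polarization of the vanishing imaginary part of the form at \<open>\<i> x + y\<close>\<close>
    have "Im (cinner (\<i> *\<^sub>C x + y) (A (\<i> *\<^sub>C x + y))) = 0" by (rule real)
    then have "Im (cinner y (A (\<i> *\<^sub>C x))) + Im (cinner (\<i> *\<^sub>C x) (A y)) = 0"
      using real[of "\<i> *\<^sub>C x"] real[of y]
      by (simp add: bounded_clinear_add[OF lin] cinner_conv_inner inner_add_left inner_add_right
          scaleC_add_right)
    then have "Re (cinner y (A x)) - Re (cinner x (A y)) = 0"
      by (simp add: bounded_clinear_scaleC[OF lin] cinner_scaleC_left cinner_scaleC_right)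
    then show "inner (A x) y = inner x (A y)"
      by (simp add: inner_eq_Re_cinner cinner_commute[of "A x" y])
  qed
next
  assume A: "bounded_clinear A \<and> symmetric_op A \<and> (\<forall>x. 0 \<le> inner x (A x))"
  have "Im (cinner x (A x)) = 0" for x
    using symmetric_op_cinner[of A x x] cinner_commute[of x "A x"] A
    by (metis complex_cnj_cancel_iff complex_In_mult_cnj_zero Reals_cnj_iff complex_is_Real_iff)
  with A show "positive_op A"
    by (auto simp: positive_op_def complex_nonneg_Reals_iff inner_eq_Re_cinner)
qed

text \<open>A symmetric operator is determined by its quadratic form, here prescribed on a dense set.\<close>

lemma symmetric_op_eqI:
  assumes A: "bounded_clinear A" "symmetric_op A" and B: "bounded_clinear B" "symmetric_op B"
    and D: "closure D = UNIV" "\<And>x. x \<in> D \<Longrightarrow> inner x (A x) = inner x (B x)"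
  shows "A = B"
proof
  let ?C = "\<lambda>x. A x - B x"
  have C: "bounded_clinear ?C" by (rule bounded_clinear_subtract) fact+
  have symm: "inner (?C x) y = inner x (?C y)" for x y
    using symmetric_opD[OF A(2)] symmetric_opD[OF B(2)] by (simp add: inner_diff_left inner_diff_right)
  have form: "inner x (?C x) = 0" for x
  proof -
    have cont: "continuous_on (closure D) (\<lambda>x. inner x (?C x))"
      by (intro continuous_intros linear_continuous_on bounded_clinear_linear[OF A(1)]
          bounded_clinear_linear[OF B(1)])
    show ?thesis
      by (rule continuous_constant_on_closure[OF cont]) (use D in \<open>auto simp: inner_diff_right\<close>)
  qed
  show "A x = B x" for x
  proof -
    \<comment> \<open>polarization of the vanishing form at \<open>x\<close> and \<open>?C x\<close>\<close>
    have "inner (x + ?C x) (?C (x + ?C x)) = 0" by (rule form)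
    then have "inner x (?C (?C x)) + inner (?C x) (?C x) = 0"
      using form[of x] form[of "?C x"]
      by (simp only: bounded_clinear_add[OF C] inner_add_left inner_add_right)
    then have "inner (?C x) (?C x) = 0" using symm[of x "?C x"] by simp
    then show ?thesis by simp
  qed
qed

text \<open>The Cauchy--Schwarz inequality for the form of a positive operator, in the shape needed
  below.\<close>

lemma positive_op_norm_le:
  assumes A: "positive_op A" and M: "M > 0" "\<And>x. norm (A x) \<le> norm x * M"
  shows "(norm (A x))\<^sup>2 \<le> M * inner x (A x)"
proof -
  have lin: "bounded_clinear A" and symm: "symmetric_op A" and pos: "0 \<le> inner y (A y)" for y
    using A by (auto simp: positive_op_iff)
  \<comment> \<open>the form at \<open>x - t A x\<close> is nonnegative; this is the best \<open>t\<close> for the estimate below\<close>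
  define t where "t = 1 / M"
  have "0 \<le> inner (x - t *\<^sub>R A x) (A (x - t *\<^sub>R A x))" by (rule pos)
  also have "\<dots> = inner x (A x) - 2 * t * inner (A x) (A x) + t\<^sup>2 * inner (A x) (A (A x))"
    by (simp add: bounded_clinear_diff[OF lin] bounded_clinear_scaleR[OF lin] inner_diff_left
        inner_diff_right symmetric_opD[OF symm, symmetric] power2_eq_square algebra_simps)
  also have "\<dots> \<le> inner x (A x) - 2 * t * (norm (A x))\<^sup>2 + t\<^sup>2 * (M * (norm (A x))\<^sup>2)"
  proof -
    have "inner (A x) (A (A x)) \<le> norm (A x) * norm (A (A x))" by (rule norm_cauchy_schwarz)
    also have "\<dots> \<le> norm (A x) * (norm (A x) * M)" by (intro mult_left_mono M) auto
    finally have "t\<^sup>2 * inner (A x) (A (A x)) \<le> t\<^sup>2 * (M * (norm (A x))\<^sup>2)"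
      by (intro mult_left_mono) (simp_all add: power2_eq_square mult.assoc mult.left_commute mult.commute[of _ M])
    then show ?thesis by (simp add: power2_norm_eq_inner)
  qed
  also have "\<dots> = inner x (A x) - (norm (A x))\<^sup>2 / M"
    using M by (simp add: t_def power2_eq_square field_simps)
  finally show ?thesis using M by (simp add: field_simps)
qed

lemma positive_op_bound:
  assumes "bounded_clinear A"
  obtains M where "M > 0" "\<And>x. norm (A x) \<le> norm x * M"
  using bounded_linear.pos_bounded[OF bounded_clinear_linear[OF assms]] by blast

lemma positive_op_form_zero:
  assumes "positive_op A" "inner x (A x) = 0"
  shows "A x = 0"
proof -
  obtain M where M: "M > 0" "\<And>x. norm (A x) \<le> norm x * M"
    using assms(1) positive_op_bound positive_op_iff by metis
  show ?thesis using positive_op_norm_le[OF assms(1) M, of x] assms(2) by simp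
qed

section \<open>The positive square root\<close>

text \<open>The Taylor coefficients of the function mapping \<open>z\<close> to the square root of \<open>1 - z\<close>.\<close>

definition sqrt_coeff :: "nat \<Rightarrow> real"
  where "sqrt_coeff k = (1/2 gchoose k) * (- 1) ^ k"

lemma sqrt_coeff_0: "sqrt_coeff 0 = 1"
  by (simp add: sqrt_coeff_def)

lemma sqrt_coeff_sum_pos: "0 \<le> (\<Sum>k\<le>n. sqrt_coeff k)"
proof -
  have "(\<Sum>k\<le>n. sqrt_coeff k) = (- 1) ^ n * (- (1/2) gchoose n)"
    unfolding sqrt_coeff_def gbinomial_sum_lower_neg by simp
  also have "\<dots> = pochhammer (1/2) n / fact n"
    by (simp add: gbinomial_pochhammer flip: power_add)
  also have "\<dots> \<ge> 0" by (simp add: pochhammer_nonneg)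
  finally show ?thesis .
qed

lemma sqrt_coeff_nonpos:
  assumes "k > 0" shows "sqrt_coeff k \<le> 0"
proof -
  obtain j where k: "k = Suc j" using assms by (cases k) auto
  have "sqrt_coeff k = pochhammer (- (1/2)) k / fact k"
    by (simp add: sqrt_coeff_def gbinomial_pochhammer mult.assoc flip: power_add)
  also have "pochhammer (- (1/2)) k = - (1/2) * pochhammer (1/2 :: real) j"
    by (simp add: k pochhammer_rec)
  finally show ?thesis by (simp add: pochhammer_nonneg divide_nonpos_pos mult_nonneg_nonneg)
qed

lemma summable_abs_sqrt_coeff: "summable (\<lambda>k. \<bar>sqrt_coeff k\<bar>)"
proof (rule bounded_imp_summable)
  show "(\<Sum>k\<le>n. \<bar>sqrt_coeff k\<bar>) \<le> 2" for n
  proof -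
    have "(\<Sum>k\<le>n. \<bar>sqrt_coeff k\<bar>) = (\<Sum>k\<le>n. (if k = 0 then 2 else 0) - sqrt_coeff k)"
      using sqrt_coeff_nonpos by (intro sum.cong) (auto simp: sqrt_coeff_0)
    also have "\<dots> = 2 - (\<Sum>k\<le>n. sqrt_coeff k)"
      by (simp add: sum_subtractf)
    finally show ?thesis using sqrt_coeff_sum_pos[of n] by linarith
  qed
qed simp

lemma sqrt_coeff_convolution:
  "(\<Sum>k\<le>n. sqrt_coeff k * sqrt_coeff (n - k)) = (if n = 0 then 1 else if n = 1 then - 1 else 0)"
proof -
  have "(\<Sum>k\<le>n. sqrt_coeff k * sqrt_coeff (n - k))
      = (\<Sum>k\<in>{0..n}. (1/2 gchoose k) * (1/2 gchoose (n - k))) * (- 1) ^ n"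
    unfolding sum_distrib_right
    by (rule sum.cong) (auto simp: sqrt_coeff_def mult.assoc mult.left_commute atMost_atLeast0
        simp flip: power_add)
  also have "\<dots> = (1 gchoose n) * (- 1) ^ n"
    by (simp add: gbinomial_Vandermonde)
  also have "(1 gchoose n :: real) = of_nat (1 choose n)"
    by (simp add: binomial_gbinomial)
  also have "\<dots> * (- 1) ^ n = (if n = 0 then 1 else if n = 1 then - 1 else 0)"
    by (auto simp: binomial_eq_0)
  finally show ?thesis .
qed

text \<open>The square root of \<open>1 - Z\<close> for a contraction \<open>Z\<close>, as a power series.\<close>

definition sqrt_series :: "('a::chilbert_space \<Rightarrow> 'a) \<Rightarrow> 'a \<Rightarrow> 'a"
  where "sqrt_series Z x = (\<Sum>k. sqrt_coeff k *\<^sub>R (Z ^^ k) x)"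

context
  fixes Z :: "'a::chilbert_space \<Rightarrow> 'a"
  assumes lin: "bounded_clinear Z" and symm: "symmetric_op Z"
    and contr: "\<And>x. norm (Z x) \<le> norm x"
begin

lemma norm_funpow_le: "norm ((Z ^^ k) x) \<le> norm x"
  by (induction k) (auto intro: order_trans[OF contr])

lemma symmetric_op_funpow: "inner ((Z ^^ k) x) y = inner x ((Z ^^ k) y)"
  by (induction k arbitrary: x y) (simp_all add: symmetric_opD[OF symm] funpow_swap1)

lemma sqrt_series_norm_summable: "summable (\<lambda>k. norm (sqrt_coeff k *\<^sub>R (Z ^^ k) x))"
proof (rule summable_comparison_test')
  show "summable (\<lambda>k. \<bar>sqrt_coeff k\<bar> * norm x)"
    by (rule summable_mult2[OF summable_abs_sqrt_coeff])
  show "norm (norm (sqrt_coeff n *\<^sub>R (Z ^^ n) x)) \<le> \<bar>sqrt_coeff n\<bar> * norm x" if "n \<ge> 0" for n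
    by (simp add: mult_left_mono norm_funpow_le)
qed

lemma sqrt_series_sums: "(\<lambda>k. sqrt_coeff k *\<^sub>R (Z ^^ k) x) sums sqrt_series Z x"
  unfolding sqrt_series_def
  using summable_norm_cancel[OF sqrt_series_norm_summable] by (rule summable_sums)

lemma sqrt_series_has_sum: "((\<lambda>k. sqrt_coeff k *\<^sub>R (Z ^^ k) x) has_sum sqrt_series Z x) UNIV"
  by (rule norm_summable_imp_has_sum[OF sqrt_series_norm_summable sqrt_series_sums])

lemma sqrt_series_bounded_clinear: "bounded_clinear (sqrt_series Z)"
proof (rule bounded_clinearI)
  note powlin = bounded_clinear_funpow[OF lin]
  show "sqrt_series Z (x + y) = sqrt_series Z x + sqrt_series Z y" for x y
    using sums_add[OF sqrt_series_sums[of x] sqrt_series_sums[of y]] sqrt_series_sums[of "x + y"]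
    by (simp add: bounded_clinear_add[OF powlin] scaleR_add_right sums_unique2)
  show "sqrt_series Z (c *\<^sub>C x) = c *\<^sub>C sqrt_series Z x" for c x
    using bounded_linear.sums[OF bounded_linear_scaleC[of c] sqrt_series_sums[of x]]
      sqrt_series_sums[of "c *\<^sub>C x"]
    by (simp add: bounded_clinear_scaleC[OF powlin] scaleC_scaleR_commute sums_unique2)
  show "norm (sqrt_series Z x) \<le> norm x * (\<Sum>k. \<bar>sqrt_coeff k\<bar>)" for x
  proof -
    have "norm (sqrt_series Z x) \<le> (\<Sum>k. norm (sqrt_coeff k *\<^sub>R (Z ^^ k) x))"
      unfolding sqrt_series_def by (rule summable_norm[OF sqrt_series_norm_summable])
    also have "\<dots> \<le> (\<Sum>k. \<bar>sqrt_coeff k\<bar> * norm x)"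
      by (intro suminf_le sqrt_series_norm_summable summable_mult2 summable_abs_sqrt_coeff)
        (simp add: mult_left_mono norm_funpow_le)
    also have "\<dots> = norm x * (\<Sum>k. \<bar>sqrt_coeff k\<bar>)"
      by (simp add: suminf_mult[OF summable_abs_sqrt_coeff] mult.commute)
    finally show ?thesis .
  qed
qed

lemma sqrt_series_positive: "positive_op (sqrt_series Z)"
  unfolding positive_op_iff
proof (intro conjI allI)
  show "bounded_clinear (sqrt_series Z)" by (rule sqrt_series_bounded_clinear)
  show "symmetric_op (sqrt_series Z)" unfolding symmetric_op_def
  proof (intro allI)
    fix x y
    have "(\<lambda>k. inner (sqrt_coeff k *\<^sub>R (Z ^^ k) x) y) sums inner (sqrt_series Z x) y"
      by (rule bounded_linear.sums[OF bounded_linear_inner_left sqrt_series_sums])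
    moreover have "(\<lambda>k. inner x (sqrt_coeff k *\<^sub>R (Z ^^ k) y)) sums inner x (sqrt_series Z y)"
      by (rule bounded_linear.sums[OF bounded_linear_inner_right sqrt_series_sums])
    ultimately show "inner (sqrt_series Z x) y = inner x (sqrt_series Z y)"
      by (simp add: symmetric_op_funpow sums_unique2)
  qed
  fix x
  have "(\<lambda>k. inner x (sqrt_coeff k *\<^sub>R (Z ^^ k) x)) sums inner x (sqrt_series Z x)"
    by (rule bounded_linear.sums[OF bounded_linear_inner_right sqrt_series_sums])
  then have lim: "(\<lambda>n. \<Sum>k\<le>n. sqrt_coeff k * inner x ((Z ^^ k) x)) \<longlonglongrightarrow> inner x (sqrt_series Z x)"
    by (simp add: sums_def_le)
  have "0 \<le> (\<Sum>k\<le>n. sqrt_coeff k * inner x ((Z ^^ k) x))" for n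
  proof -
    have "0 \<le> (\<Sum>k\<le>n. sqrt_coeff k) * (norm x)\<^sup>2"
      by (intro mult_nonneg_nonneg sqrt_coeff_sum_pos) simp
    also have "\<dots> = (\<Sum>k\<le>n. sqrt_coeff k * (norm x)\<^sup>2)" by (rule sum_distrib_right)
    also have "\<dots> \<le> (\<Sum>k\<le>n. sqrt_coeff k * inner x ((Z ^^ k) x))"
    proof (rule sum_mono)
      fix k
      have "inner x ((Z ^^ k) x) \<le> norm x * norm ((Z ^^ k) x)" by (rule norm_cauchy_schwarz)
      also have "\<dots> \<le> norm x * norm x" by (intro mult_left_mono norm_funpow_le) simp
      finally have "inner x ((Z ^^ k) x) \<le> (norm x)\<^sup>2" by (simp add: power2_eq_square)
      then show "sqrt_coeff k * (norm x)\<^sup>2 \<le> sqrt_coeff k * inner x ((Z ^^ k) x)"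
        using sqrt_coeff_nonpos[of k]
        by (cases "k = 0") (auto simp: power2_norm_eq_inner intro: mult_left_mono_neg)
    qed
    finally show ?thesis .
  qed
  with lim show "0 \<le> inner x (sqrt_series Z x)" by (intro LIMSEQ_le_const) auto
qed

lemma sqrt_series_commute:
  assumes B: "bounded_clinear B" "\<And>x. B (Z x) = Z (B x)"
  shows "B (sqrt_series Z x) = sqrt_series Z (B x)"
proof -
  have "B ((Z ^^ k) x) = (Z ^^ k) (B x)" for k by (induction k) (simp_all add: B)
  with bounded_linear.sums[OF bounded_clinear_linear[OF B(1)] sqrt_series_sums[of x]]
    sqrt_series_sums[of "B x"]
  show ?thesis by (simp add: bounded_clinear_scaleR[OF B(1)] sums_unique2)
qed

text \<open>The Cauchy product of the series with itself, arranged as an absolutely convergent sum over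
  pairs of indices.\<close>

lemma sqrt_series_square: "sqrt_series Z (sqrt_series Z x) = x - Z x"
proof -
  define f where "f = (\<lambda>(j, k). (sqrt_coeff j * sqrt_coeff k) *\<^sub>R (Z ^^ (j + k)) x)"
  define c where "c = (\<Sum>k. \<bar>sqrt_coeff k\<bar>)"
  have c: "((\<lambda>k. \<bar>sqrt_coeff k\<bar>) has_sum c) UNIV"
    unfolding c_def using summable_abs_sqrt_coeff
    by (intro norm_summable_imp_has_sum summable_sums) auto
  have "(\<lambda>(j, k). \<bar>sqrt_coeff j\<bar> * (\<bar>sqrt_coeff k\<bar> * norm x)) summable_on UNIV \<times> UNIV"
  proof (rule summable_on_SigmaI)
    show "((\<lambda>k. (\<lambda>(j, k). \<bar>sqrt_coeff j\<bar> * (\<bar>sqrt_coeff k\<bar> * norm x)) (j, k)) has_sum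
        \<bar>sqrt_coeff j\<bar> * (c * norm x)) UNIV" for j
      by simp (intro has_sum_cmult_right has_sum_cmult_left c)
    show "(\<lambda>j. \<bar>sqrt_coeff j\<bar> * (c * norm x)) summable_on UNIV"
      by (intro summable_on_cmult_left has_sum_imp_summable[OF c])
  qed auto
  then have "(\<lambda>p. norm (f p)) summable_on UNIV \<times> UNIV"
    by (rule summable_on_comparison_test)
      (auto simp: f_def abs_mult mult.assoc intro!: mult_left_mono norm_funpow_le)
  then have f: "f summable_on UNIV \<times> UNIV" by (rule abs_summable_summable)
  have "((\<lambda>j. sqrt_coeff j *\<^sub>R (Z ^^ j) (sqrt_series Z x)) has_sum infsum f (UNIV \<times> UNIV)) UNIV"
  proof (rule has_sum_SigmaD[OF has_sum_infsum[OF f]])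
    fix j
    have "bounded_linear (\<lambda>y. sqrt_coeff j *\<^sub>R (Z ^^ j) y)"
      by (intro bounded_clinear_linear bounded_clinear_scale bounded_clinear_funpow lin)
    from has_sum_bounded_linear[OF this sqrt_series_has_sum]
    show "((\<lambda>k. f (j, k)) has_sum sqrt_coeff j *\<^sub>R (Z ^^ j) (sqrt_series Z x)) UNIV"
      by (simp add: f_def comp_def funpow_add bounded_clinear_scaleR[OF bounded_clinear_funpow[OF lin]])
  qed
  then have 1: "infsum f (UNIV \<times> UNIV) = sqrt_series Z (sqrt_series Z x)"
    using sqrt_series_has_sum has_sum_unique by blast
  have "(f has_sum infsum f (UNIV \<times> UNIV)) (UNIV \<times> UNIV) \<longleftrightarrow>
      ((\<lambda>(n, j). f (j, n - j)) has_sum infsum f (UNIV \<times> UNIV)) (SIGMA n:UNIV. {..n})"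
    by (rule has_sum_reindex_bij_witness[where i = "\<lambda>(n, j). (j, n - j)" and j = "\<lambda>(j, k). (j + k, j)"])
      auto
  then have "((\<lambda>(n, j). f (j, n - j)) has_sum infsum f (UNIV \<times> UNIV)) (SIGMA n:UNIV. {..n})"
    using has_sum_infsum[OF f] by simp
  then have "((\<lambda>n. (\<Sum>k\<le>n. sqrt_coeff k * sqrt_coeff (n - k)) *\<^sub>R (Z ^^ n) x)
      has_sum infsum f (UNIV \<times> UNIV)) UNIV"
  proof (rule has_sum_SigmaD)
    show "((\<lambda>j. (\<lambda>(n, j). f (j, n - j)) (n, j)) has_sum
        (\<Sum>k\<le>n. sqrt_coeff k * sqrt_coeff (n - k)) *\<^sub>R (Z ^^ n) x) {..n}" for n
      by (rule has_sum_finiteI) (auto simp: f_def scaleR_sum_left)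
  qed
  then have "((\<lambda>n. (if n = 0 then 1 else if n = 1 then - 1 else 0) *\<^sub>R (Z ^^ n) x)
      has_sum infsum f (UNIV \<times> UNIV)) UNIV"
    by (simp add: sqrt_coeff_convolution)
  moreover have "((\<lambda>n. (if n = 0 then 1 else if n = 1 then - 1 else 0) *\<^sub>R (Z ^^ n) x)
      has_sum (x - Z x)) UNIV"
    by (rule has_sum_finite_neutralI[where B = "{0, 1}"]) auto
  ultimately have "infsum f (UNIV \<times> UNIV) = x - Z x" by (rule has_sum_unique)
  with 1 show ?thesis by simp
qed

end

text \<open>Besides being a square root, the operator obtained from the series commutes with everything
  that commutes with \<open>A\<close>; uniqueness of the positive square root rests on this.\<close>

lemma positive_sqrt_ex:
  fixes A :: "'a::chilbert_space \<Rightarrow> 'a"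
  assumes A: "positive_op A"
  obtains B where "positive_op B" "\<And>x. B (B x) = A x"
    "\<And>C x. bounded_clinear C \<Longrightarrow> (\<And>y. C (A y) = A (C y)) \<Longrightarrow> C (B x) = B (C x)"
proof -
  have Alin: "bounded_clinear A" and Asymm: "symmetric_op A" and Apos: "0 \<le> inner y (A y)" for y
    using A by (auto simp: positive_op_iff)
  obtain M where M: "M > 0" "\<And>x. norm (A x) \<le> norm x * M" using positive_op_bound[OF Alin] by blast
  \<comment> \<open>\<open>M\<close> bounds the norm of \<open>A\<close>, so that \<open>A / M = 1 - Z\<close> for a contraction \<open>Z\<close>\<close>
  define Z where "Z = (\<lambda>x. x - (1/M) *\<^sub>R A x)"
  have lin: "bounded_clinear Z" unfolding Z_def
    by (intro bounded_clinear_subtract bounded_clinear_id bounded_clinear_scale Alin)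
  have symm: "symmetric_op Z"
    using symmetric_opD[OF Asymm] by (simp add: symmetric_op_def Z_def inner_diff_left inner_diff_right)
  have contr: "norm (Z x) \<le> norm x" for x
  proof -
    have "(norm (Z x))\<^sup>2 = (norm x)\<^sup>2 - 2 * (inner x (A x) / M) + (norm (A x))\<^sup>2 / M\<^sup>2"
      unfolding power2_norm_eq_inner Z_def
      by (simp add: inner_diff_left inner_diff_right inner_commute[of "A x" x] power2_eq_square diff_divide_distrib)
    also have "(norm (A x))\<^sup>2 / M\<^sup>2 \<le> M * inner x (A x) / M\<^sup>2"
      by (intro divide_right_mono positive_op_norm_le A M) simp
    also have "M * inner x (A x) / M\<^sup>2 = inner x (A x) / M" using M by (simp add: power2_eq_square)
    also have "(norm x)\<^sup>2 - 2 * (inner x (A x) / M) + inner x (A x) / M \<le> (norm x)\<^sup>2"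
      using Apos[of x] M by simp
    finally show ?thesis by (simp add: power2_le_iff_abs_le)
  qed
  note props = lin symm contr
  define B where "B = (\<lambda>x. sqrt M *\<^sub>R sqrt_series Z x)"
  have S: "positive_op (sqrt_series Z)" by (rule sqrt_series_positive[OF props])
  show thesis
  proof
    show "positive_op B"
      using S M by (auto simp: positive_op_iff B_def symmetric_op_def intro: bounded_clinear_scale)
    show "B (B x) = A x" for x
    proof -
      have "B (B x) = (sqrt M * sqrt M) *\<^sub>R sqrt_series Z (sqrt_series Z x)"
        using S by (simp add: B_def positive_op_iff bounded_clinear_scaleR)
      also have "\<dots> = A x" unfolding sqrt_series_square[OF props] using M by (simp add: Z_def)
      finally show ?thesis .
    qed
    show "C (B x) = B (C x)" if C: "bounded_clinear C" "\<And>y. C (A y) = A (C y)" for C x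
    proof -
      have "C (Z y) = Z (C y)" for y
        by (simp add: Z_def C bounded_clinear_diff[OF C(1)] bounded_clinear_scaleR[OF C(1)])
      from sqrt_series_commute[OF props C(1) this]
      show ?thesis by (simp add: B_def bounded_clinear_scaleR[OF C(1)])
    qed
  qed
qed

lemma positive_sqrt_ex1:
  fixes A :: "'a::chilbert_space \<Rightarrow> 'a"
  assumes A: "positive_op A"
  shows "\<exists>!B. positive_op B \<and> B \<circ> B = A"
proof -
  obtain S where S: "positive_op S" "\<And>x. S (S x) = A x"
    and comm: "\<And>C x. bounded_clinear C \<Longrightarrow> (\<And>y. C (A y) = A (C y)) \<Longrightarrow> C (S x) = S (C x)"
    using positive_sqrt_ex[OF A] by metis
  show ?thesis
  proof (rule ex1I[of _ S])
    show "positive_op S \<and> S \<circ> S = A" using S by auto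
    fix B assume "positive_op B \<and> B \<circ> B = A"
    then have B: "positive_op B" "\<And>x. B (B x) = A x" by auto
    have Slin: "bounded_clinear S" and Blin: "bounded_clinear B"
      using S B by (auto simp: positive_op_iff)
    have BS: "B (S x) = S (B x)" for x
      by (rule comm) (simp_all add: Blin flip: B(2))
    show "B = S"
    proof
      fix x
      \<comment> \<open>\<open>(S + B) (S - B) = S\<^sup>2 - B\<^sup>2 = 0\<close>, and both forms at \<open>y\<close> are nonnegative\<close>
      define y where "y = S x - B x"
      have "S y + B y = 0"
        unfolding y_def
        by (simp add: bounded_clinear_diff[OF Slin] bounded_clinear_diff[OF Blin] BS S B)
      then have "inner y (S y) + inner y (B y) = 0" by (metis inner_add_right inner_zero_right)
      then have "inner y (S y) = 0" "inner y (B y) = 0"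
        using S(1) B(1) by (simp_all add: positive_op_iff add_nonneg_eq_0_iff)
      then have "S y = 0" "B y = 0" using positive_op_form_zero S(1) B(1) by auto
      moreover have "inner y y = inner x (S y - B y)"
        using S(1) B(1) unfolding positive_op_iff
        by (subst y_def) (simp add: inner_diff_left inner_diff_right symmetric_opD)
      ultimately show "B x = S x" by (simp add: y_def)
    qed
  qed
qed

lemma
  fixes A :: "'a::chilbert_space \<Rightarrow> 'a"
  assumes "positive_op A"
  shows positive_sqrt_op: "positive_op (sqrt_op A)"
    and sqrt_op_square: "sqrt_op A (sqrt_op A x) = A x"
  using theI'[OF positive_sqrt_ex1[OF assms]] by (auto simp: sqrt_op_def fun_eq_iff)

lemma inner_sqrt_op:
  fixes A :: "'a::chilbert_space \<Rightarrow> 'a"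
  assumes "positive_op A"
  shows "inner (sqrt_op A x) (sqrt_op A x) = inner x (A x)"
  using positive_sqrt_op[OF assms] sqrt_op_square[OF assms]
  by (simp add: positive_op_iff symmetric_opD)

lemma sqrt_op_bounded_clinear:
  fixes A :: "'a::chilbert_space \<Rightarrow> 'a"
  shows "positive_op A \<Longrightarrow> bounded_clinear (sqrt_op A)"
  using positive_sqrt_op positive_op_iff by blast

section \<open>Extension by continuity\<close>

lemma closure_pair_sequential:
  fixes x :: "'a::metric_space" and p :: "'b::metric_space"
  shows "(x, p) \<in> closure G \<longleftrightarrow> (\<exists>f g. (\<forall>n. (f n, g n) \<in> G) \<and> f \<longlonglongrightarrow> x \<and> g \<longlonglongrightarrow> p)"
proof
  assume "(x, p) \<in> closure G"
  then obtain h where h: "\<And>n. h n \<in> G" "h \<longlonglongrightarrow> (x, p)" unfolding closure_sequential by blast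
  from tendsto_fst[OF h(2)] tendsto_snd[OF h(2)] h(1)
  show "\<exists>f g. (\<forall>n. (f n, g n) \<in> G) \<and> f \<longlonglongrightarrow> x \<and> g \<longlonglongrightarrow> p"
    by (intro exI[of _ "fst \<circ> h"] exI[of _ "snd \<circ> h"]) (simp add: comp_def)
next
  assume "\<exists>f g. (\<forall>n. (f n, g n) \<in> G) \<and> f \<longlonglongrightarrow> x \<and> g \<longlonglongrightarrow> p"
  then show "(x, p) \<in> closure G"
    unfolding closure_sequential by (auto intro: tendsto_Pair)
qed

lemma
  fixes x :: "'a::real_normed_vector" and p :: "'b::real_normed_vector"
  shows closure_graph_fst: "(x, p) \<in> closure G \<Longrightarrow> x \<in> closure (fst ` G)"
  and closure_graph_snd: "(x, p) \<in> closure G \<Longrightarrow> p \<in> closure (snd ` G)"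
  using closure_bounded_linear_image_subset[OF bounded_linear_fst, of G]
    closure_bounded_linear_image_subset[OF bounded_linear_snd, of G]
  by (auto simp: image_subset_iff)

text \<open>A complex linear relation that does not increase norms is the graph of a contraction; its
  closure is the graph of the extension of that contraction to the closure of the domain.\<close>

definition contraction_graph :: "('a::complex_inner \<times> 'b::complex_inner) set \<Rightarrow> bool"
  where "contraction_graph G \<longleftrightarrow>
    (\<forall>x p y q. (x, p) \<in> G \<longrightarrow> (y, q) \<in> G \<longrightarrow> (x + y, p + q) \<in> G) \<and>
    (\<forall>c x p. (x, p) \<in> G \<longrightarrow> (c *\<^sub>C x, c *\<^sub>C p) \<in> G) \<and>
    (\<forall>x p. (x, p) \<in> G \<longrightarrow> norm p \<le> norm x)"

text \<open>The value of the extension at a point outside the closure of the domain is unspecified.\<close>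

definition graph_extension :: "('a::complex_inner \<times> 'b::complex_inner) set \<Rightarrow> 'a \<Rightarrow> 'b"
  where "graph_extension G x = (THE p. (x, p) \<in> closure G)"

context
  fixes G :: "('a::complex_inner \<times> 'b::chilbert_space) set"
  assumes G: "contraction_graph G"
begin

lemma
  shows graph_add: "(x, p) \<in> G \<Longrightarrow> (y, q) \<in> G \<Longrightarrow> (x + y, p + q) \<in> G"
    and graph_scale: "(x, p) \<in> G \<Longrightarrow> (c *\<^sub>C x, c *\<^sub>C p) \<in> G"
    and graph_bound: "(x, p) \<in> G \<Longrightarrow> norm p \<le> norm x"
  using G unfolding contraction_graph_def by blast+

lemma graph_diff: "(x, p) \<in> G \<Longrightarrow> (y, q) \<in> G \<Longrightarrow> (x - y, p - q) \<in> G"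
  using graph_add[of x p "(- 1) *\<^sub>C y" "(- 1) *\<^sub>C q"] graph_scale[of y q "- 1"]
    by (simp add: minus_one_scaleC)

lemma closure_graph_add:
  assumes "(x, p) \<in> closure G" "(y, q) \<in> closure G"
  shows "(x + y, p + q) \<in> closure G"
proof -
  obtain f g where 1: "\<And>n. (f n, g n) \<in> G" "f \<longlonglongrightarrow> x" "g \<longlonglongrightarrow> p"
    using assms(1) by (auto simp: closure_pair_sequential)
  obtain f' g' where 2: "\<And>n. (f' n, g' n) \<in> G" "f' \<longlonglongrightarrow> y" "g' \<longlonglongrightarrow> q"
    using assms(2) by (auto simp: closure_pair_sequential)
  show ?thesis unfolding closure_pair_sequential
    by (intro exI[of _ "\<lambda>n. f n + f' n"] exI[of _ "\<lambda>n. g n + g' n"])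
      (auto intro!: graph_add 1 2 tendsto_add)
qed

lemma closure_graph_scale:
  assumes "(x, p) \<in> closure G"
  shows "(c *\<^sub>C x, c *\<^sub>C p) \<in> closure G"
proof -
  obtain f g where 1: "\<And>n. (f n, g n) \<in> G" "f \<longlonglongrightarrow> x" "g \<longlonglongrightarrow> p"
    using assms by (auto simp: closure_pair_sequential)
  show ?thesis unfolding closure_pair_sequential
    by (intro exI[of _ "\<lambda>n. c *\<^sub>C f n"] exI[of _ "\<lambda>n. c *\<^sub>C g n"])
      (auto intro!: graph_scale 1 tendsto_scaleC)
qed

lemma closure_graph_bound:
  assumes "(x, p) \<in> closure G"
  shows "norm p \<le> norm x"
proof -
  obtain f g where 1: "\<And>n. (f n, g n) \<in> G" "f \<longlonglongrightarrow> x" "g \<longlonglongrightarrow> p"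
    using assms by (auto simp: closure_pair_sequential)
  show ?thesis
    by (rule LIMSEQ_le[OF tendsto_norm[OF 1(3)] tendsto_norm[OF 1(2)]]) (auto intro: graph_bound 1)
qed

lemma closure_graph_unique:
  assumes "(x, p) \<in> closure G" "(x, q) \<in> closure G"
  shows "p = q"
  using closure_graph_bound[OF closure_graph_add[OF assms(1) closure_graph_scale[OF assms(2), of "- 1"]]]
    by (simp add: minus_one_scaleC)

lemma closure_graph_total:
  assumes "x \<in> closure (fst ` G)"
  obtains p where "(x, p) \<in> closure G"
proof -
  obtain f where f: "\<And>n. f n \<in> fst ` G" "f \<longlonglongrightarrow> x" using assms by (auto simp: closure_sequential)
  then have "\<forall>n. \<exists>p. (f n, p) \<in> G" by force
  then obtain g where g: "\<And>n. (f n, g n) \<in> G" by metis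
  have "Cauchy g" unfolding Cauchy_def
  proof (intro allI impI)
    fix e :: real assume "e > 0"
    with LIMSEQ_imp_Cauchy[OF f(2)]
    obtain N where N: "\<And>m n. m \<ge> N \<Longrightarrow> n \<ge> N \<Longrightarrow> dist (f m) (f n) < e"
      unfolding Cauchy_def by metis
    have "dist (g m) (g n) \<le> dist (f m) (f n)" for m n
      using graph_bound[OF graph_diff[OF g g]] by (simp add: dist_norm)
    with N show "\<exists>N. \<forall>m\<ge>N. \<forall>n\<ge>N. dist (g m) (g n) < e" by (meson le_less_trans)
  qed
  then obtain p where "g \<longlonglongrightarrow> p" using Cauchy_convergent_iff convergent_def by blast
  with f(2) g have "(x, p) \<in> closure G" by (auto simp: closure_pair_sequential)
  then show thesis by (rule that)
qed

lemma graph_extension_eqI: "(x, p) \<in> closure G \<Longrightarrow> graph_extension G x = p"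
  unfolding graph_extension_def using closure_graph_unique by blast

lemma graph_extension_mem: "x \<in> closure (fst ` G) \<Longrightarrow> (x, graph_extension G x) \<in> closure G"
  using closure_graph_total graph_extension_eqI by metis

lemma graph_extension_add:
  "x \<in> closure (fst ` G) \<Longrightarrow> y \<in> closure (fst ` G) \<Longrightarrow>
    graph_extension G (x + y) = graph_extension G x + graph_extension G y"
  by (intro graph_extension_eqI closure_graph_add graph_extension_mem)

lemma graph_extension_scale:
  "x \<in> closure (fst ` G) \<Longrightarrow> graph_extension G (c *\<^sub>C x) = c *\<^sub>C graph_extension G x"
  by (intro graph_extension_eqI closure_graph_scale graph_extension_mem)

lemma graph_extension_bound:
  "x \<in> closure (fst ` G) \<Longrightarrow> norm (graph_extension G x) \<le> norm x"
  by (intro closure_graph_bound graph_extension_mem)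

lemma graph_extension_eq: "(x, p) \<in> G \<Longrightarrow> graph_extension G x = p"
  using graph_extension_eqI closure_subset by blast

end

text \<open>A densely defined linear relation that is symmetric and idempotent extends to an orthogonal
  projection; its boundedness comes from the Cauchy--Schwarz inequality.\<close>

lemma orth_projection_graph:
  fixes G :: "('a::chilbert_space \<times> 'a) set"
  assumes add: "\<And>x p y q. (x, p) \<in> G \<Longrightarrow> (y, q) \<in> G \<Longrightarrow> (x + y, p + q) \<in> G"
    and scale: "\<And>c x p. (x, p) \<in> G \<Longrightarrow> (c *\<^sub>C x, c *\<^sub>C p) \<in> G"
    and symm: "\<And>x p y q. (x, p) \<in> G \<Longrightarrow> (y, q) \<in> G \<Longrightarrow> inner p y = inner x q"
    and idem: "\<And>x p. (x, p) \<in> G \<Longrightarrow> (p, p) \<in> G"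
    and dense: "closure (fst ` G) = UNIV"
  obtains Q where "orth_projection Q" "\<And>x p. (x, p) \<in> G \<Longrightarrow> Q x = p"
proof -
  have bound: "norm p \<le> norm x" if "(x, p) \<in> G" for x p
  proof -
    have "norm p * norm p = inner x p"
      using symm[OF that idem[OF that]] by (simp add: power2_norm_eq_inner flip: power2_eq_square)
    also have "\<dots> \<le> norm x * norm p" by (rule norm_cauchy_schwarz)
    finally show ?thesis by (cases "p = 0") auto
  qed
  have G: "contraction_graph G" unfolding contraction_graph_def using add scale bound by blast
  have total: "x \<in> closure (fst ` G)" for x using dense by simp
  define Q where "Q = graph_extension G"
  have mem: "(x, Q x) \<in> closure G" for x
    unfolding Q_def by (rule graph_extension_mem[OF G total])
  have "bounded_clinear Q"
    unfolding Q_def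
    by (rule bounded_clinearI[where K = 1])
      (use graph_extension_add[OF G total total] graph_extension_scale[OF G total]
        graph_extension_bound[OF G total] in auto)
  moreover have "symmetric_op Q" unfolding symmetric_op_def
  proof (intro allI)
    fix x y
    obtain f g where 1: "\<And>n. (f n, g n) \<in> G" "f \<longlonglongrightarrow> x" "g \<longlonglongrightarrow> Q x"
      using mem[of x] by (auto simp: closure_pair_sequential)
    obtain f' g' where 2: "\<And>n. (f' n, g' n) \<in> G" "f' \<longlonglongrightarrow> y" "g' \<longlonglongrightarrow> Q y"
      using mem[of y] by (auto simp: closure_pair_sequential)
    have "inner (g n) (f' n) = inner (f n) (g' n)" for n by (rule symm[OF 1(1) 2(1)])
    moreover have "(\<lambda>n. inner (g n) (f' n)) \<longlonglongrightarrow> inner (Q x) y"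
      and "(\<lambda>n. inner (f n) (g' n)) \<longlonglongrightarrow> inner x (Q y)"
      by (intro tendsto_inner 1 2)+
    ultimately show "inner (Q x) y = inner x (Q y)" by (simp add: LIMSEQ_unique)
  qed
  moreover have "Q (Q x) = Q x" for x
  proof -
    obtain f g where 1: "\<And>n. (f n, g n) \<in> G" "g \<longlonglongrightarrow> Q x"
      using mem[of x] by (auto simp: closure_pair_sequential)
    have "(g n, g n) \<in> G" for n by (rule idem[OF 1(1)])
    with 1(2) have "(Q x, Q x) \<in> closure G" by (auto simp: closure_pair_sequential)
    then have "graph_extension G (Q x) = Q x" by (rule graph_extension_eqI[OF G])
    then show ?thesis by (simp add: Q_def)
  qed
  ultimately have "orth_projection Q" by (simp add: orth_projection_iff)
  moreover have "Q x = p" if "(x, p) \<in> G" for x p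
    unfolding Q_def by (rule graph_extension_eq[OF G that])
  ultimately show thesis by (rule that)
qed

text \<open>If \<open>B\<close> is dominated by \<open>A\<close>, there is exactly one contraction with \<open>C (A h) = B h\<close> from the
  closure of the range of \<open>A\<close> to that of \<open>B\<close>; this is what the definition of the edge contractions
  asks for.\<close>

lemma contraction_ex1:
  fixes A :: "'a::complex_inner \<Rightarrow> 'b::complex_inner" and B :: "'a \<Rightarrow> 'c::chilbert_space"
  assumes A: "bounded_clinear A" and B: "bounded_clinear B" and le: "\<And>h. norm (B h) \<le> norm (A h)"
  defines "R \<equiv> closure (range A)"
  shows "\<exists>!C. C \<in> R \<rightarrow>\<^sub>E closure (range B) \<and>
    (\<forall>x \<in> R. \<forall>y \<in> R. C (x + y) = C x + C y) \<and> (\<forall>c. \<forall>x \<in> R. C (c *\<^sub>C x) = c *\<^sub>C C x) \<and>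
    (\<forall>x \<in> R. norm (C x) \<le> norm x) \<and> (\<forall>h. C (A h) = B h)" (is "\<exists>!C. ?P C")
proof (rule ex_ex1I)
  define G where "G = range (\<lambda>h. (A h, B h))"
  have G_iff: "(x, p) \<in> G \<longleftrightarrow> (\<exists>h. x = A h \<and> p = B h)" for x p by (auto simp: G_def)
  have add: "(x + y, p + q) \<in> G" if "(x, p) \<in> G" "(y, q) \<in> G" for x p y q
    using that bounded_clinear_add[OF A] bounded_clinear_add[OF B] unfolding G_iff by metis
  have scale: "(c *\<^sub>C x, c *\<^sub>C p) \<in> G" if "(x, p) \<in> G" for c x p
    using that bounded_clinear_scaleC[OF A] bounded_clinear_scaleC[OF B] unfolding G_iff by metis
  have bound: "norm p \<le> norm x" if "(x, p) \<in> G" for x p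
    using that le by (auto simp: G_iff)
  have G: "contraction_graph G" unfolding contraction_graph_def using add scale bound by blast
  have R: "closure (fst ` G) = R" by (simp add: G_def R_def image_image)
  have AR: "A h \<in> R" for h unfolding R_def by (rule subsetD[OF closure_subset]) simp
  have sumR: "x + y \<in> R" if "x \<in> R" "y \<in> R" for x y
    by (rule closure_graph_fst[OF closure_graph_add[OF G graph_extension_mem[OF G] graph_extension_mem[OF G]],
          unfolded R, OF that])
  have scaleR: "c *\<^sub>C x \<in> R" if "x \<in> R" for c x
    by (rule closure_graph_fst[OF closure_graph_scale[OF G graph_extension_mem[OF G]], unfolded R, OF that])
  show "\<exists>C. ?P C"
  proof (rule exI[of _ "restrict (graph_extension G) R"], intro conjI)
    have "graph_extension G x \<in> closure (range B)" if "x \<in> R" for x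
      using closure_graph_snd[OF graph_extension_mem[OF G, unfolded R, OF that]]
      by (simp add: G_def image_image)
    then show "restrict (graph_extension G) R \<in> R \<rightarrow>\<^sub>E closure (range B)" by auto
    show "\<forall>h. restrict (graph_extension G) R (A h) = B h"
      using AR graph_extension_eq[OF G] by (auto simp: G_iff)
    show "\<forall>x \<in> R. \<forall>y \<in> R. restrict (graph_extension G) R (x + y)
        = restrict (graph_extension G) R x + restrict (graph_extension G) R y"
      by (simp add: sumR graph_extension_add[OF G, unfolded R])
    show "\<forall>c. \<forall>x \<in> R. restrict (graph_extension G) R (c *\<^sub>C x) = c *\<^sub>C restrict (graph_extension G) R x"
      by (simp add: scaleR graph_extension_scale[OF G, unfolded R])
    show "\<forall>x \<in> R. norm (restrict (graph_extension G) R x) \<le> norm x"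
      by (simp add: graph_extension_bound[OF G, unfolded R])
  qed
  fix C D assume C: "?P C" and D: "?P D"
  have determined: "(\<lambda>n. B (h n)) \<longlonglongrightarrow> F x" if F: "?P F" and x: "x \<in> R" and h: "(\<lambda>n. A (h n)) \<longlonglongrightarrow> x"
    for F h x
  proof (rule metric_tendsto_imp_tendsto[OF h], rule always_eventually, rule allI)
    fix n
    from F have Fadd: "\<forall>x \<in> R. \<forall>y \<in> R. F (x + y) = F x + F y" and Fbound: "\<forall>x \<in> R. norm (F x) \<le> norm x"
      and FA: "\<forall>h. F (A h) = B h"
      by - (elim conjE, assumption)+
    have diffR: "x - A (h n) \<in> R"
      using sumR[OF x scaleR[OF AR, of "- 1"], of "h n"] by (simp add: minus_one_scaleC)
    have "F x = F ((x - A (h n)) + A (h n))" by simp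
    also have "\<dots> = F (x - A (h n)) + F (A (h n))" by (rule Fadd[rule_format, OF diffR AR])
    also have "F (A (h n)) = B (h n)" using FA by simp
    finally have "norm (F x - B (h n)) = norm (F (x - A (h n)))" by simp
    also have "\<dots> \<le> norm (x - A (h n))" using Fbound diffR by simp
    finally show "dist (B (h n)) (F x) \<le> dist (A (h n)) x"
      by (simp add: dist_norm norm_minus_commute)
  qed
  show "C = D"
  proof (rule PiE_ext)
    show "C \<in> R \<rightarrow>\<^sub>E closure (range B)" "D \<in> R \<rightarrow>\<^sub>E closure (range B)"
      using conjunct1[OF C] conjunct1[OF D] .
    fix x assume x: "x \<in> R"
    then obtain f where f: "\<And>n. f n \<in> range A" "f \<longlonglongrightarrow> x" by (auto simp: R_def closure_sequential)
    then have "\<forall>n. \<exists>h. f n = A h" by blast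
    then obtain h where "f = (\<lambda>n. A (h n))" by metis
    with f(2) have h: "(\<lambda>n. A (h n)) \<longlonglongrightarrow> x" by simp
    show "C x = D x"
      by (rule LIMSEQ_unique[OF determined[OF C x h] determined[OF D x h]])
  qed
qed

section \<open>Cylinder sets and operator-valued measures\<close>

lemma space_Omega: "space (Omega m) = {x. \<forall>i. x i < m}"
  by (auto simp: Omega_def space_PiM PiE_UNIV_domain)

lemma words_iff: "w \<in> words m n \<longleftrightarrow> w \<in> lists {..<m} \<and> length w = n"
  by (simp add: words_def)

lemma finite_words: "finite (words m n)"
  using finite_lists_length_eq[of "{..<m}" n] by (simp add: words_def lists_eq_set)

lemma cyl_iff: "x \<in> cyl m w \<longleftrightarrow> x \<in> space (Omega m) \<and> map x [0..<length w] = w"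
  unfolding cyl_def list_eq_iff_nth_eq[of "map x [0..<length w]"] by simp

lemma cyl_subset_space: "cyl m w \<subseteq> space (Omega m)"
  by (auto simp: cyl_def)

lemma cyl_mono: "prefix v w \<Longrightarrow> cyl m w \<subseteq> cyl m v"
proof
  fix x assume "prefix v w" and x: "x \<in> cyl m w"
  then obtain u where w: "w = v @ u" by (auto simp: prefix_def)
  have "x i = v ! i" if "i < length v" for i
  proof -
    have "x i = w ! i" using x that by (simp add: cyl_def w)
    with that show ?thesis by (simp add: w nth_append)
  qed
  with x show "x \<in> cyl m v" by (simp add: cyl_def)
qed

lemma cyl_disjoint: "\<not> prefix v w \<Longrightarrow> \<not> prefix w v \<Longrightarrow> cyl m w \<inter> cyl m v = {}"
proof (rule ccontr)
  assume 1: "\<not> prefix v w" "\<not> prefix w v" and "cyl m w \<inter> cyl m v \<noteq> {}"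
  then obtain x where "x \<in> cyl m w" "x \<in> cyl m v" by blast
  then have "map x [0..<length w] = w" "map x [0..<length v] = v" by (auto simp: cyl_iff)
  moreover have "prefix (map x [0..<i]) (map x [0..<j])" if "i \<le> j" for i j
    using take_is_prefix[of i "map x [0..<j]"] that by (simp add: take_map)
  ultimately show False using 1 by (metis nle_le)
qed

lemma UN_cyl_words: "(\<Union>w\<in>words m n. cyl m w) = space (Omega m)"
proof
  show "space (Omega m) \<subseteq> (\<Union>w\<in>words m n. cyl m w)"
  proof
    fix x assume x: "x \<in> space (Omega m)"
    then have "map x [0..<n] \<in> words m n" by (auto simp: words_iff space_Omega)
    moreover have "x \<in> cyl m (map x [0..<n])" using x by (simp add: cyl_iff)
    ultimately show "x \<in> (\<Union>w\<in>words m n. cyl m w)" by blast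
  qed
qed (use cyl_subset_space in blast)

lemma cyl_Suc: "cyl m w = (\<Union>j<m. cyl m (w @ [j]))"
proof (intro equalityI subsetI)
  fix x assume x: "x \<in> cyl m w"
  have "x i = (w @ [x (length w)]) ! i" if "i < Suc (length w)" for i
  proof (cases "i = length w")
    case False
    with that have i: "i < length w" by simp
    with x have "x i = w ! i" by (simp add: cyl_def)
    with i show ?thesis by (simp add: nth_append)
  qed simp
  moreover have "x \<in> space (Omega m)" using x by (simp add: cyl_def)
  ultimately have "x \<in> cyl m (w @ [x (length w)])" unfolding cyl_def length_append_singleton by blast
  moreover have "x (length w) < m" using x by (simp add: cyl_def space_Omega)
  ultimately show "x \<in> (\<Union>j<m. cyl m (w @ [j]))" by blast
next
  fix x assume "x \<in> (\<Union>j<m. cyl m (w @ [j]))"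
  then obtain j where "x \<in> cyl m (w @ [j])" by blast
  moreover have "prefix w (w @ [j])" by simp
  ultimately show "x \<in> cyl m w" using cyl_mono by blast
qed

lemma sets_cyl: "cyl m w \<in> sets (Omega m)"
proof -
  have meas: "(\<lambda>x. x i) \<in> measurable (Omega m) (count_space {..<m})" for i
    unfolding Omega_def by (rule measurable_component_singleton) (rule UNIV_I)
  have single: "{x \<in> space (Omega m). x i = a} \<in> sets (Omega m)" for i a
  proof -
    have eq: "{x \<in> space (Omega m). x i = a} = (\<lambda>x. x i) -` ({a} \<inter> {..<m}) \<inter> space (Omega m)"
      unfolding space_Omega by blast
    show ?thesis unfolding eq by (rule measurable_sets[OF meas]) simp
  qed
  have eq: "cyl m w = {x \<in> space (Omega m). \<forall>i\<in>{..<length w}. x i = w ! i}"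
    unfolding cyl_def by blast
  show ?thesis unfolding eq by (rule sets.sets_Collect_finite_All[OF single]) (rule finite_lessThan)
qed

text \<open>The empty set is added to the cylinder sets to make the generating family closed under
  intersections.\<close>

definition cylinders :: "nat \<Rightarrow> (nat \<Rightarrow> nat) set set"
  where "cylinders m = insert {} (cyl m ` lists {..<m})"

lemma Int_stable_cylinders: "Int_stable (cylinders m)"
proof (rule Int_stableI)
  fix A B assume AB: "A \<in> cylinders m" "B \<in> cylinders m"
  show "A \<inter> B \<in> cylinders m"
  proof (cases "A = {} \<or> B = {}")
    case True
    then show ?thesis by (auto simp: cylinders_def)
  next
    case False
    with AB obtain v w where A: "A = cyl m v" and B: "B = cyl m w" by (auto simp: cylinders_def)
    consider "prefix v w" | "prefix w v" | "\<not> prefix v w" "\<not> prefix w v" by blast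
    then have "A \<inter> B = B \<or> A \<inter> B = A \<or> A \<inter> B = {}"
      using cyl_mono cyl_disjoint unfolding A B by cases blast+
    with AB show ?thesis by (auto simp: cylinders_def)
  qed
qed

lemma cylinders_subset_Pow: "cylinders m \<subseteq> Pow (space (Omega m))"
  using cyl_subset_space by (auto simp: cylinders_def)

lemma sets_Omega: "sets (Omega m) = sigma_sets (space (Omega m)) (cylinders m)"
proof
  show "sigma_sets (space (Omega m)) (cylinders m) \<subseteq> sets (Omega m)"
    by (rule sets.sigma_sets_subset) (auto simp: cylinders_def sets_cyl)
  have "sets (Omega m) = sigma_sets (space (Omega m))
      {{f \<in> space (Omega m). f i \<in> A} | i A. i \<in> UNIV \<and> A \<in> sets (count_space {..<m})}"
    unfolding Omega_def space_PiM by (rule sets_PiM_single)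
  also have "\<dots> \<subseteq> sigma_sets (space (Omega m)) (cylinders m)"
  proof (rule sigma_sets_mono, rule subsetI)
    interpret sigma_algebra "space (Omega m)" "sigma_sets (space (Omega m)) (cylinders m)"
      by (rule sigma_algebra_sigma_sets[OF cylinders_subset_Pow])
    fix B assume "B \<in> {{f \<in> space (Omega m). f i \<in> A} | i A. i \<in> UNIV \<and> A \<in> sets (count_space {..<m})}"
    then obtain i A where B: "B = {f \<in> space (Omega m). f i \<in> A}" by blast
    have "B = (\<Union>w\<in>{w \<in> words m (Suc i). w ! i \<in> A}. cyl m w)"
    proof (intro equalityI subsetI)
      fix f assume f: "f \<in> B"
      then obtain w where w: "w \<in> words m (Suc i)" "f \<in> cyl m w"
        using UN_cyl_words[of m "Suc i"] by (auto simp: B)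
      then have "f i = w ! i" by (simp add: cyl_def words_iff)
      with f w show "f \<in> (\<Union>w\<in>{w \<in> words m (Suc i). w ! i \<in> A}. cyl m w)" by (auto simp: B)
    next
      fix f assume "f \<in> (\<Union>w\<in>{w \<in> words m (Suc i). w ! i \<in> A}. cyl m w)"
      then obtain w where "w \<in> words m (Suc i)" "w ! i \<in> A" "f \<in> cyl m w" by blast
      then show "f \<in> B" by (simp add: B cyl_def words_iff)
    qed
    also have "\<dots> \<in> sigma_sets (space (Omega m)) (cylinders m)"
    proof (rule finite_UN)
      show "finite {w \<in> words m (Suc i). w ! i \<in> A}" by (simp add: finite_words)
      show "cyl m w \<in> sigma_sets (space (Omega m)) (cylinders m)"
        if "w \<in> {w \<in> words m (Suc i). w ! i \<in> A}" for w
        using that by (intro sigma_sets.Basic) (simp add: cylinders_def words_iff)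
    qed
    finally show "B \<in> sigma_sets (space (Omega m)) (cylinders m)" .
  qed
  finally show "sets (Omega m) \<subseteq> sigma_sets (space (Omega m)) (cylinders m)" .
qed

lemma povm_positive: "povm m E \<Longrightarrow> A \<in> sets (Omega m) \<Longrightarrow> positive_op (E A)"
  unfolding povm_def by blast

lemma povm_space: "povm m E \<Longrightarrow> E (space (Omega m)) x = x"
  by (simp add: povm_def)

lemma povm_sums:
  assumes "povm m E" "range A \<subseteq> sets (Omega m)" "disjoint_family (A :: nat \<Rightarrow> _)"
  shows "(\<lambda>i. inner x (E (A i) y)) sums inner x (E (\<Union>i. A i) y)"
proof -
  have "(\<lambda>i. cinner x (E (A i) y)) sums cinner x (E (\<Union>i. A i) y)"
    using assms unfolding povm_def by blast
  then have "(\<lambda>i. Re (cinner x (E (A i) y))) sums Re (cinner x (E (\<Union>i. A i) y))" by (rule sums_Re)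
  then show ?thesis by (simp add: inner_eq_Re_cinner)
qed

lemma povm_empty:
  assumes "povm m E"
  shows "E {} y = 0"
proof -
  have "(\<lambda>i::nat. inner (E {} y) (E {} y)) sums inner (E {} y) (E (\<Union>i::nat. {}) y)"
    by (rule povm_sums[OF assms]) (auto simp: disjoint_family_on_def)
  then have "summable (\<lambda>i::nat. inner (E {} y) (E {} y))" by (rule sums_summable)
  then show ?thesis by (simp add: summable_const_iff)
qed

lemma povm_Un:
  assumes E: "povm m E" and AB: "A \<in> sets (Omega m)" "B \<in> sets (Omega m)" "A \<inter> B = {}"
  shows "E (A \<union> B) y = E A y + E B y"
proof (rule vector_eq_ldot[THEN iffD1], rule allI)
  fix x
  have "disjoint_family (binaryset A B)"
    using AB by (auto simp: disjoint_family_on_def binaryset_def)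
  moreover have "range (binaryset A B) \<subseteq> sets (Omega m)"
    using AB by (simp add: range_binaryset_eq)
  ultimately have "(\<lambda>i. inner x (E (binaryset A B i) y)) sums inner x (E (\<Union>i. binaryset A B i) y)"
    by (intro povm_sums[OF E])
  moreover have "(\<lambda>i. inner x (E (binaryset A B i) y)) sums (inner x (E A y) + inner x (E B y))"
    by (rule binaryset_sums) (simp add: povm_empty[OF E])
  ultimately show "inner x (E (A \<union> B) y) = inner x (E A y + E B y)"
    by (simp add: UN_binaryset_eq sums_unique2 inner_add_right)
qed

lemma povm_finite_UN:
  assumes E: "povm m E" and "finite I" "\<And>i. i \<in> I \<Longrightarrow> A i \<in> sets (Omega m)" "disjoint_family_on A I"
  shows "E (\<Union>i\<in>I. A i) y = (\<Sum>i\<in>I. E (A i) y)"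
  using assms(2-)
proof (induction I rule: finite_induct)
  case empty
  show ?case by (simp add: povm_empty[OF E])
next
  case (insert i I)
  have "A i \<inter> A j = {}" if "j \<in> I" for j
    using insert.prems(2) insert.hyps(2) that by (intro disjoint_family_onD[of A "insert i I"]) auto
  then have "A i \<inter> (\<Union>j\<in>I. A j) = {}" by blast
  then have "E (A i \<union> (\<Union>j\<in>I. A j)) y = E (A i) y + E (\<Union>j\<in>I. A j) y"
    using insert.prems(1) insert.hyps(1) by (intro povm_Un[OF E] sets.finite_UN) auto
  also have "E (\<Union>j\<in>I. A j) y = (\<Sum>j\<in>I. E (A j) y)"
    using insert.prems by (intro insert.IH) (auto simp: disjoint_family_on_def)
  finally show ?case using insert.hyps by simp
qed

lemma povm_mono:
  assumes E: "povm m E" and AB: "A \<in> sets (Omega m)" "B \<in> sets (Omega m)" "A \<subseteq> B"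
  shows "inner y (E A y) \<le> inner y (E B y)"
proof -
  have "E (A \<union> (B - A)) y = E A y + E (B - A) y"
    using AB by (intro povm_Un[OF E]) auto
  moreover have "A \<union> (B - A) = B" using AB by blast
  moreover have "0 \<le> inner y (E (B - A) y)"
    using povm_positive[OF E, of "B - A"] AB by (auto simp: positive_op_iff)
  ultimately show ?thesis by (simp add: inner_add_right)
qed

lemma povm_compl:
  assumes E: "povm m E" and A: "A \<in> sets (Omega m)"
  shows "E (space (Omega m) - A) y = y - E A y"
proof -
  have "E (A \<union> (space (Omega m) - A)) y = E A y + E (space (Omega m) - A) y"
    using A by (intro povm_Un[OF E]) auto
  moreover have "A \<union> (space (Omega m) - A) = space (Omega m)" using sets.sets_into_space[OF A] by blast
  ultimately show ?thesis using povm_space[OF E, of y] by (simp add: algebra_simps)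
qed

text \<open>An operator-valued measure is determined by its values on the cylinder sets.\<close>

lemma povm_eqI:
  assumes E: "povm m E" and F: "povm m F" and eq: "\<And>w. w \<in> lists {..<m} \<Longrightarrow> E (cyl m w) = F (cyl m w)"
    and A: "A \<in> sets (Omega m)"
  shows "E A = F A"
proof -
  from A have A': "A \<in> sigma_sets (space (Omega m)) (cylinders m)" by (simp add: sets_Omega)
  show ?thesis
    using Int_stable_cylinders cylinders_subset_Pow A'
  proof (induction rule: sigma_sets_induct_disjoint)
    case (basic A)
    then show ?case using povm_empty[OF E] povm_empty[OF F] eq by (auto simp: cylinders_def fun_eq_iff)
  next
    case empty
    show ?case using povm_empty[OF E] povm_empty[OF F] by (simp add: fun_eq_iff)
  next
    case (compl A)
    then show ?case using povm_compl[OF E] povm_compl[OF F] by (simp add: sets_Omega fun_eq_iff)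
  next
    case (union A)
    then have A: "range A \<subseteq> sets (Omega m)" by (simp add: sets_Omega)
    show ?case
    proof
      fix y
      show "E (\<Union>i. A i) y = F (\<Union>i. A i) y"
      proof (rule vector_eq_ldot[THEN iffD1], rule allI)
        fix x
        have "(\<lambda>i. inner x (E (A i) y)) sums inner x (E (\<Union>i. A i) y)"
          by (rule povm_sums[OF E A union(1)])
        moreover have "(\<lambda>i. inner x (F (A i) y)) sums inner x (F (\<Union>i. A i) y)"
          by (rule povm_sums[OF F A union(1)])
        ultimately show "inner x (E (\<Union>i. A i) y) = inner x (F (\<Union>i. A i) y)"
          using union by (simp add: sums_unique2)
      qed
    qed
  qed
qed

section \<open>Series of orthogonal projections\<close>

lemma orth_projectionD:
  assumes "orth_projection P"
  shows orth_projection_bounded_clinear: "bounded_clinear P"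
    and orth_projection_symmetric: "symmetric_op P"
    and orth_projection_idem: "P (P x) = P x"
    and orth_projection_inner: "inner x (P x) = (norm (P x))\<^sup>2"
proof -
  show "bounded_clinear P" and symm: "symmetric_op P" and idem: "P (P x) = P x"
    using assms by (auto simp: orth_projection_iff)
  show "inner x (P x) = (norm (P x))\<^sup>2"
    using symmetric_opD[OF symm, of x "P x"] by (simp add: power2_norm_eq_inner idem)
qed

lemma orth_projection_positive: "orth_projection P \<Longrightarrow> positive_op P"
  unfolding positive_op_iff
  using orth_projectionD(1,2) orth_projectionD(4)[of P] by (metis zero_le_power2)

text \<open>Projections whose finite sums stay below the identity are mutually orthogonal, and their
  series converges strongly to a projection.\<close>

lemma orth_projection_series:
  fixes Q :: "nat \<Rightarrow> 'a::chilbert_space \<Rightarrow> 'a"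
  assumes Q: "\<And>i. orth_projection (Q i)"
    and le: "\<And>n x. (\<Sum>i<n. inner x (Q i x)) \<le> inner x x"
  obtains T where "orth_projection T" "\<And>x. (\<lambda>i. Q i x) sums T x"
proof -
  note lin = orth_projection_bounded_clinear[OF Q] and symm = orth_projection_symmetric[OF Q]
    and idem = orth_projection_idem[OF Q] and form = orth_projection_inner[OF Q]
  have orth: "Q i (Q j x) = 0" if "i \<noteq> j" for i j x
  proof -
    \<comment> \<open>at \<open>Q j x\<close> the term of index \<open>j\<close> alone exhausts the bound\<close>
    let ?y = "Q j x"
    have "(\<Sum>k\<in>{i, j}. inner ?y (Q k ?y)) \<le> (\<Sum>k<Suc (max i j). inner ?y (Q k ?y))"
      by (rule sum_mono2) (auto simp: form)
    also have "\<dots> \<le> inner ?y ?y" by (rule le)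
    finally have "inner ?y (Q i ?y) \<le> 0" using that by (simp add: idem)
    then show ?thesis by (simp add: form)
  qed
  have norm_sum: "(norm (\<Sum>i\<in>F. Q i x))\<^sup>2 = (\<Sum>i\<in>F. inner x (Q i x))" if "finite F" for F x
  proof -
    have "inner (Q i x) (Q j x) = (if i = j then inner x (Q i x) else 0)" for i j
      using symmetric_opD[OF symm, of i x "Q j x"] orth[of i j] by (auto simp: idem)
    then have "inner (\<Sum>i\<in>F. Q i x) (\<Sum>j\<in>F. Q j x) = (\<Sum>i\<in>F. inner x (Q i x))"
      using that by (simp add: inner_sum_left inner_sum_right)
    then show ?thesis by (simp add: power2_norm_eq_inner)
  qed
  have "summable (\<lambda>i. Q i x)" for x
  proof -
    have "summable (\<lambda>i. inner x (Q i x))"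
    proof (rule bounded_imp_summable)
      show "0 \<le> inner x (Q i x)" for i by (simp add: form)
      show "(\<Sum>i\<le>n. inner x (Q i x)) \<le> inner x x" for n
        using le[of x "Suc n"] by (simp add: lessThan_Suc_atMost)
    qed
    then have cauchy: "\<forall>e>0. \<exists>N. \<forall>k\<ge>N. \<forall>n. norm (\<Sum>i=k..<n. inner x (Q i x)) < e"
      by (simp add: summable_Cauchy)
    show ?thesis unfolding summable_Cauchy
    proof (intro allI impI)
      fix e :: real assume e: "e > 0"
      then obtain N where N: "\<And>k n. k \<ge> N \<Longrightarrow> norm (\<Sum>i=k..<n. inner x (Q i x)) < e\<^sup>2"
        using cauchy by (metis zero_less_power)
      have "norm (\<Sum>i=k..<n. Q i x) < e" if "k \<ge> N" for k n
      proof (rule power2_less_imp_less)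
        show "(norm (\<Sum>i=k..<n. Q i x))\<^sup>2 < e\<^sup>2"
          using N[OF that, of n] by (simp add: norm_sum)
      qed (use e in simp)
      then show "\<exists>N. \<forall>k\<ge>N. \<forall>n. norm (\<Sum>i=k..<n. Q i x) < e" by blast
    qed
  qed
  define T where "T = (\<lambda>x. \<Sum>i. Q i x)"
  have T: "(\<lambda>i. Q i x) sums T x" for x
    unfolding T_def using \<open>summable (\<lambda>i. Q i x)\<close> by (rule summable_sums)
  have "bounded_clinear T"
  proof (rule bounded_clinearI)
    show "T (x + y) = T x + T y" for x y
      using sums_add[OF T[of x] T[of y]] T[of "x + y"]
      by (simp add: bounded_clinear_add[OF lin] sums_unique2)
    show "T (c *\<^sub>C x) = c *\<^sub>C T x" for c x
      using bounded_linear.sums[OF bounded_linear_scaleC[of c] T[of x]] T[of "c *\<^sub>C x"]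
      by (simp add: bounded_clinear_scaleC[OF lin] sums_unique2)
    show "norm (T x) \<le> norm x * 1" for x
    proof -
      have "norm (\<Sum>i<n. Q i x) \<le> norm x" for n
      proof (rule power2_le_imp_le)
        show "(norm (\<Sum>i<n. Q i x))\<^sup>2 \<le> (norm x)\<^sup>2"
          using le[where n = n and x = x] by (simp add: norm_sum power2_norm_eq_inner[of x])
      qed simp
      moreover have "(\<lambda>n. norm (\<Sum>i<n. Q i x)) \<longlonglongrightarrow> norm (T x)"
        using T by (intro tendsto_norm) (simp add: sums_def)
      ultimately show ?thesis by (auto intro: LIMSEQ_le_const2)
    qed
  qed
  moreover have "symmetric_op T" unfolding symmetric_op_def
  proof (intro allI)
    fix x y
    have "(\<lambda>i. inner (Q i x) y) sums inner (T x) y"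
      by (rule bounded_linear.sums[OF bounded_linear_inner_left T])
    moreover have "(\<lambda>i. inner x (Q i y)) sums inner x (T y)"
      by (rule bounded_linear.sums[OF bounded_linear_inner_right T])
    ultimately show "inner (T x) y = inner x (T y)"
      by (simp add: symmetric_opD[OF symm] sums_unique2)
  qed
  moreover have "T (T x) = T x" for x
  proof -
    have "Q i (T x) = Q i x" for i
    proof -
      have "(\<lambda>j. Q i (Q j x)) sums Q i (T x)"
        by (rule bounded_linear.sums[OF bounded_clinear_linear[OF lin] T])
      moreover have "(\<lambda>j. Q i (Q j x)) sums (\<Sum>j\<in>{i}. Q i (Q j x))"
        by (rule sums_finite) (auto simp: orth)
      ultimately show ?thesis by (simp add: idem sums_unique2)
    qed
    then show ?thesis using T[of "T x"] T[of x] by (simp add: sums_unique2)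
  qed
  ultimately have "orth_projection T" by (simp add: orth_projection_iff)
  then show thesis using T by (rule that)
qed

section \<open>The level spaces\<close>

lemma words_SucE:
  assumes "u \<in> words m (Suc n)"
  obtains v j where "u = v @ [j]" "v \<in> words m n" "j < m"
  using assms by (cases u rule: rev_cases) (auto simp: words_iff)

lemma words_snoc: "v @ [j] \<in> words m (Suc n) \<longleftrightarrow> v \<in> words m n \<and> j < m"
  by (auto simp: words_iff)

lemma sum_words_Suc: "(\<Sum>u\<in>words m (Suc n). f u) = (\<Sum>v\<in>words m n. \<Sum>j<m. f (v @ [j]))"
proof -
  have "(\<Sum>u\<in>words m (Suc n). f u) = (\<Sum>(v, j)\<in>words m n \<times> {..<m}. f (v @ [j]))"
    by (rule sum.reindex_bij_witness[where i = "\<lambda>(v, j). v @ [j]" and j = "\<lambda>u. (butlast u, last u)"])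
      (auto simp: words_snoc elim!: words_SucE)
  then show ?thesis by (simp add: sum.cartesian_product)
qed

text \<open>The component of a family of vectors over the words extending \<open>w\<close>.\<close>

definition restrict_ext :: "nat list \<Rightarrow> (nat list \<Rightarrow> 'h::zero) \<Rightarrow> nat list \<Rightarrow> 'h"
  where "restrict_ext w x = (\<lambda>u. if prefix w u then x u else 0)"

text \<open>The tower of level spaces of an operator-valued measure \<open>E\<close>.\<close>

locale povm_tower =
  fixes m :: nat and E :: "(nat \<Rightarrow> nat) set \<Rightarrow> 'h::chilbert_space \<Rightarrow> 'h"
  assumes povm: "povm m E"
begin

abbreviation S :: "nat list \<Rightarrow> 'h \<Rightarrow> 'h"
  where "S w \<equiv> sqrt_op (E (cyl m w))"

lemma S_lin: "bounded_clinear (S w)"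
  by (intro sqrt_op_bounded_clinear povm_positive[OF povm] sets_cyl)

lemma inner_S: "inner (S w h) (S w h) = inner h (E (cyl m w) h)"
  by (intro inner_sqrt_op povm_positive[OF povm] sets_cyl)

lemma norm_S_snoc_le: "norm (S (w @ [j]) h) \<le> norm (S w h)"
proof (rule power2_le_imp_le)
  have "cyl m (w @ [j]) \<subseteq> cyl m w" by (rule cyl_mono) simp
  then show "(norm (S (w @ [j]) h))\<^sup>2 \<le> (norm (S w h))\<^sup>2"
    unfolding power2_norm_eq_inner inner_S by (intro povm_mono[OF povm] sets_cyl)
qed simp

lemma edge_contraction_prop:
  "edge_contraction m E w j \<in> range_space m E w \<rightarrow>\<^sub>E range_space m E (w @ [j]) \<and>
    (\<forall>x \<in> range_space m E w. \<forall>y \<in> range_space m E w.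
      edge_contraction m E w j (x + y) = edge_contraction m E w j x + edge_contraction m E w j y) \<and>
    (\<forall>c. \<forall>x \<in> range_space m E w.
      edge_contraction m E w j (c *\<^sub>C x) = c *\<^sub>C edge_contraction m E w j x) \<and>
    (\<forall>x \<in> range_space m E w. norm (edge_contraction m E w j x) \<le> norm x) \<and>
    (\<forall>h. edge_contraction m E w j (S w h) = S (w @ [j]) h)"
  unfolding edge_contraction_def range_space_def
  by (rule theI'[OF contraction_ex1[OF S_lin S_lin norm_S_snoc_le]])

lemma edge_contraction_S: "edge_contraction m E w j (S w h) = S (w @ [j]) h"
  using edge_contraction_prop[of w j] by (elim conjE) (erule spec)

lemma edge_contraction_zero: "edge_contraction m E w j 0 = 0"
  using edge_contraction_S[of w j 0] by (simp add: bounded_clinear_zero[OF S_lin])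

lemma edge_contraction_mem:
  "x \<in> range_space m E w \<Longrightarrow> edge_contraction m E w j x \<in> range_space m E (w @ [j])"
  using conjunct1[OF edge_contraction_prop[of w j]] by (rule PiE_mem)

lemma S_mem: "S w h \<in> range_space m E w"
  unfolding range_space_def by (rule subsetD[OF closure_subset]) (rule rangeI)

lemma zero_mem: "0 \<in> range_space m E w"
  using S_mem[of w 0] by (simp add: bounded_clinear_zero[OF S_lin])

lemma range_space_approx:
  assumes "x \<in> range_space m E w"
  obtains h where "(\<lambda>k. S w (h k)) \<longlonglongrightarrow> x"
proof -
  obtain f where f: "\<And>n. f n \<in> range (S w)" "f \<longlonglongrightarrow> x"
    using assms by (auto simp: range_space_def closure_sequential)
  then have "\<forall>n. \<exists>h. f n = S w h" by blast
  then obtain h where "f = (\<lambda>k. S w (h k))" by metis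
  with f(2) show thesis using that by simp
qed

lemma range_space_add:
  assumes "x \<in> range_space m E w" "y \<in> range_space m E w"
  shows "x + y \<in> range_space m E w"
proof -
  obtain h where h: "(\<lambda>k. S w (h k)) \<longlonglongrightarrow> x" by (rule range_space_approx[OF assms(1)])
  obtain g where g: "(\<lambda>k. S w (g k)) \<longlonglongrightarrow> y" by (rule range_space_approx[OF assms(2)])
  have "(\<lambda>k. S w (h k + g k)) \<longlonglongrightarrow> x + y"
    using tendsto_add[OF h g] by (simp add: bounded_clinear_add[OF S_lin])
  then show ?thesis unfolding range_space_def closure_sequential
    by (intro exI[of _ "\<lambda>k. S w (h k + g k)"]) simp
qed

lemma range_space_scale:
  assumes "x \<in> range_space m E w"
  shows "c *\<^sub>C x \<in> range_space m E w"
proof -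
  obtain h where h: "(\<lambda>k. S w (h k)) \<longlonglongrightarrow> x" by (rule range_space_approx[OF assms])
  have "(\<lambda>k. S w (c *\<^sub>C h k)) \<longlonglongrightarrow> c *\<^sub>C x"
    using tendsto_scaleC[OF h] by (simp add: bounded_clinear_scaleC[OF S_lin])
  then show ?thesis unfolding range_space_def closure_sequential
    by (intro exI[of _ "\<lambda>k. S w (c *\<^sub>C h k)"]) simp
qed

lemma level_add: "x \<in> level m E n \<Longrightarrow> y \<in> level m E n \<Longrightarrow> (\<lambda>w. x w + y w) \<in> level m E n"
  by (simp add: level_def range_space_add)

lemma level_scale: "x \<in> level m E n \<Longrightarrow> (\<lambda>w. c *\<^sub>C x w) \<in> level m E n"
  by (simp add: level_def range_space_scale)

lemma level_diff: "x \<in> level m E n \<Longrightarrow> y \<in> level m E n \<Longrightarrow> (\<lambda>w. x w - y w) \<in> level m E n"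
  using level_add[of x n "\<lambda>w. (- 1) *\<^sub>C y w"] level_scale[of y n "- 1"] by (simp add: minus_one_scaleC)

lemma level_restrict_ext: "x \<in> level m E n \<Longrightarrow> restrict_ext w x \<in> level m E n"
  by (simp add: level_def restrict_ext_def zero_mem)

lemma level_proj_eq:
  assumes x: "x \<in> level m E n"
  shows "level_proj m E n w x = restrict_ext w x"
  unfolding level_proj_def
proof (rule the_equality)
  have mem: "restrict_ext w x \<in> sublevel m E n w"
    using level_restrict_ext[OF x] by (simp add: sublevel_def restrict_ext_def)
  have orth: "level_inner m n (\<lambda>u. x u - restrict_ext w x u) z = 0" if "z \<in> sublevel m E n w" for z
    unfolding level_inner_def
  proof (rule sum.neutral, rule ballI)
    fix u assume u: "u \<in> words m n"
    show "cinner (x u - restrict_ext w x u) (z u) = 0"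
    proof (cases "prefix w u")
      case True
      then show ?thesis by (simp add: restrict_ext_def cinner_zero_left)
    next
      case False
      then have "z u = 0" using that u by (simp add: sublevel_def)
      then show ?thesis using cinner_commute[of _ "z u"] by (simp add: cinner_zero_left)
    qed
  qed
  from mem orth show "restrict_ext w x \<in> sublevel m E n w \<and>
    (\<forall>z \<in> sublevel m E n w. level_inner m n (\<lambda>u. x u - restrict_ext w x u) z = 0)" by blast
  fix y assume "y \<in> sublevel m E n w \<and>
    (\<forall>z \<in> sublevel m E n w. level_inner m n (\<lambda>u. x u - y u) z = 0)"
  then have y: "y \<in> sublevel m E n w"
    and yorth: "\<And>z. z \<in> sublevel m E n w \<Longrightarrow> level_inner m n (\<lambda>u. x u - y u) z = 0" by auto
  define d where "d = (\<lambda>u. y u - restrict_ext w x u)"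
  have "d \<in> level m E n" unfolding d_def
    using y by (intro level_diff level_restrict_ext x) (simp add: sublevel_def)
  then have d: "d \<in> sublevel m E n w"
    using y mem by (simp add: sublevel_def d_def)
  have "level_inner m n d d
      = level_inner m n (\<lambda>u. x u - restrict_ext w x u) d - level_inner m n (\<lambda>u. x u - y u) d"
    by (simp add: level_inner_def d_def sum_subtractf[symmetric] cinner_diff_left)
  then have "(\<Sum>u\<in>words m n. cinner (d u) (d u)) = 0"
    using orth[OF d] yorth[OF d] by (simp add: level_inner_def)
  then have "(\<Sum>u\<in>words m n. inner (d u) (d u)) = 0"
    by (simp add: inner_eq_Re_cinner flip: Re_sum)
  then have zero: "\<forall>u\<in>words m n. d u = 0"
    by (simp add: sum_nonneg_eq_0_iff finite_words)
  have "d u = 0" for u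
    using zero \<open>d \<in> level m E n\<close> by (cases "u \<in> words m n") (auto simp: level_def)
  then show "y = restrict_ext w x" by (simp add: d_def fun_eq_iff)
qed

lemma level_map_mem:
  assumes x: "x \<in> level m E n"
  shows "level_map m E n x \<in> level m E (Suc n)"
proof -
  have "edge_contraction m E (butlast u) (last u) (x (butlast u)) \<in> range_space m E u"
    if u: "u \<in> words m (Suc n)" for u
  proof -
    obtain v j where u: "u = v @ [j]" "v \<in> words m n" using u by (rule words_SucE)
    then have "x v \<in> range_space m E v" using x by (simp add: level_def)
    then show ?thesis using edge_contraction_mem[of "x v" v j] by (simp add: u)
  qed
  then show ?thesis by (simp add: level_def level_map_def)
qed

text \<open>For \<open>length w \<le> n\<close>, a word \<open>v @ [j]\<close> with \<open>length v = n\<close> extends \<open>w\<close> if and only if \<open>v\<close> does.\<close>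

lemma restrict_ext_level_map:
  assumes "length w \<le> n"
  shows "restrict_ext w (level_map m E n x) = level_map m E n (restrict_ext w x)"
proof
  fix u
  show "restrict_ext w (level_map m E n x) u = level_map m E n (restrict_ext w x) u"
  proof (cases "u \<in> words m (Suc n)")
    case True
    then obtain v j where u: "u = v @ [j]" "v \<in> words m n" by (rule words_SucE)
    then have "w \<noteq> v @ [j]" using assms by (auto simp: words_iff)
    then have "prefix w u \<longleftrightarrow> prefix w v" by (simp add: u)
    with True show ?thesis by (simp add: restrict_ext_def level_map_def u edge_contraction_zero)
  next
    case False
    then show ?thesis by (simp add: restrict_ext_def level_map_def)
  qed
qed

text \<open>The vectors of the \<open>n\<close>-th level space with components \<open>S w (h w)\<close>; they are dense there.\<close>

definition root_vector :: "nat \<Rightarrow> (nat list \<Rightarrow> 'h) \<Rightarrow> nat list \<Rightarrow> 'h"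
  where "root_vector n h = (\<lambda>u. if u \<in> words m n then S u (h u) else 0)"

lemma root_vector_mem: "root_vector n h \<in> level m E n"
  by (simp add: root_vector_def level_def S_mem)

lemma level_map_root_vector:
  "level_map m E n (root_vector n h) = root_vector (Suc n) (\<lambda>u. h (butlast u))"
proof
  fix u
  show "level_map m E n (root_vector n h) u = root_vector (Suc n) (\<lambda>u. h (butlast u)) u"
  proof (cases "u \<in> words m (Suc n)")
    case True
    then obtain v j where u: "u = v @ [j]" "v \<in> words m n" by (rule words_SucE)
    with True show ?thesis by (simp add: level_map_def root_vector_def edge_contraction_S)
  qed (simp add: level_map_def root_vector_def)
qed

text \<open>The value on \<open>A\<close> of the quadratic form that the dilated measure is going to have at the image
  of \<open>root_vector n h\<close> in the limit space.\<close>

definition mass :: "nat \<Rightarrow> (nat list \<Rightarrow> 'h) \<Rightarrow> (nat \<Rightarrow> nat) set \<Rightarrow> real"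
  where "mass n h A = (\<Sum>u\<in>words m n. inner (h u) (E (A \<inter> cyl m u) (h u)))"

lemma mass_space: "mass n h (space (Omega m)) = (\<Sum>u\<in>words m n. inner (root_vector n h u) (root_vector n h u))"
  unfolding mass_def
  by (rule sum.cong) (simp_all add: root_vector_def inner_S Int_absorb1[OF cyl_subset_space])

lemma mass_nonneg:
  assumes "A \<in> sets (Omega m)"
  shows "0 \<le> mass n h A"
  unfolding mass_def
proof (rule sum_nonneg)
  show "0 \<le> inner (h u) (E (A \<inter> cyl m u) (h u))" for u
    using povm_positive[OF povm, of "A \<inter> cyl m u"] assms sets_cyl by (auto simp: positive_op_iff)
qed

lemma mass_Un:
  assumes "A \<in> sets (Omega m)" "B \<in> sets (Omega m)" "A \<inter> B = {}"
  shows "mass n h (A \<union> B) = mass n h A + mass n h B"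
proof -
  have "E ((A \<union> B) \<inter> cyl m u) y = E (A \<inter> cyl m u) y + E (B \<inter> cyl m u) y" for u y
    unfolding Int_Un_distrib2
    using assms by (intro povm_Un[OF povm] sets.Int sets_cyl) auto
  then show ?thesis by (simp add: mass_def inner_add_right sum.distrib)
qed

lemma mass_sums:
  assumes "range A \<subseteq> sets (Omega m)" "disjoint_family A"
  shows "(\<lambda>i. mass n h (A i)) sums mass n h (\<Union>i. A i)"
  unfolding mass_def
proof (rule sums_sum)
  fix u
  have "range (\<lambda>i. A i \<inter> cyl m u) \<subseteq> sets (Omega m)" using assms(1) sets_cyl by auto
  moreover have "disjoint_family (\<lambda>i. A i \<inter> cyl m u)"
    using assms(2) unfolding disjoint_family_on_def by blast
  ultimately have "(\<lambda>i. inner (h u) (E (A i \<inter> cyl m u) (h u))) sums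
      inner (h u) (E (\<Union>i. A i \<inter> cyl m u) (h u))"
    by (rule povm_sums[OF povm])
  then show "(\<lambda>i. inner (h u) (E (A i \<inter> cyl m u) (h u))) sums
      inner (h u) (E ((\<Union>i. A i) \<inter> cyl m u) (h u))" by simp
qed

text \<open>The families \<open>h\<close> and \<open>\<lambda>u. h (butlast u)\<close> yield the same vector of the limit space, by
  \<open>level_map_root_vector\<close>; accordingly they have the same mass.\<close>

lemma mass_Suc:
  assumes A: "A \<in> sets (Omega m)"
  shows "mass (Suc n) (\<lambda>u. h (butlast u)) A = mass n h A"
proof -
  have "(\<Sum>j<m. inner y (E (A \<inter> cyl m (v @ [j])) y)) = inner y (E (A \<inter> cyl m v) y)" for v y
  proof -
    have "disjoint_family_on (\<lambda>j. A \<inter> cyl m (v @ [j])) {..<m}"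
      unfolding disjoint_family_on_def using cyl_disjoint[of "v @ [i]" "v @ [j]" m for i j] by fastforce
    then have "E (\<Union>j<m. A \<inter> cyl m (v @ [j])) y = (\<Sum>j<m. E (A \<inter> cyl m (v @ [j])) y)"
      using A by (intro povm_finite_UN[OF povm] sets.Int sets_cyl) auto
    moreover have "(\<Union>j<m. A \<inter> cyl m (v @ [j])) = A \<inter> cyl m v" using cyl_Suc[of m v] by blast
    ultimately show ?thesis by (simp add: inner_sum_right)
  qed
  then show ?thesis by (simp add: mass_def sum_words_Suc)
qed

end

section \<open>The dilated measure on the direct limit\<close>

text \<open>A direct limit of the tower, given by the canonical isometries \<open>U n\<close>.\<close>

locale povm_limit = povm_tower m E
  for m :: nat and E :: "(nat \<Rightarrow> nat) set \<Rightarrow> 'h::chilbert_space \<Rightarrow> 'h" +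
  fixes U :: "nat \<Rightarrow> (nat list \<Rightarrow> 'h) \<Rightarrow> 'k::chilbert_space"
  assumes limit: "direct_limit m E U"
begin

lemma
  shows U_add: "x \<in> level m E n \<Longrightarrow> y \<in> level m E n \<Longrightarrow> U n (\<lambda>w. x w + y w) = U n x + U n y"
    and U_scale: "x \<in> level m E n \<Longrightarrow> U n (\<lambda>w. c *\<^sub>C x w) = c *\<^sub>C U n x"
    and U_cinner: "x \<in> level m E n \<Longrightarrow> y \<in> level m E n \<Longrightarrow> cinner (U n x) (U n y) = level_inner m n x y"
    and U_level_map: "x \<in> level m E n \<Longrightarrow> U (Suc n) (level_map m E n x) = U n x"
    and U_dense: "closure (\<Union>n. U n ` level m E n) = UNIV"
  using limit unfolding direct_limit_def by blast+

lemma U_inner: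
  assumes "x \<in> level m E n" "y \<in> level m E n"
  shows "inner (U n x) (U n y) = (\<Sum>u\<in>words m n. inner (x u) (y u))"
  using U_cinner[OF assms] by (simp add: inner_eq_Re_cinner level_inner_def)

lemma U_diff:
  assumes "x \<in> level m E n" "y \<in> level m E n"
  shows "U n (\<lambda>w. x w - y w) = U n x - U n y"
  using U_add[OF assms(1) level_scale[OF assms(2), of "- 1"]] U_scale[OF assms(2), of "- 1"]
  by (simp add: minus_one_scaleC)

text \<open>A vector of the limit space coming from level \<open>n\<close> comes from every higher level as well, and the
  image of its restriction does not change either, for words \<open>w\<close> with \<open>length w \<le> n\<close>.\<close>

lemma U_lift:
  assumes x: "x \<in> level m E n" and "n \<le> k"
  shows "\<exists>y\<in>level m E k. U k y = U n x \<and>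
    (\<forall>w. length w \<le> n \<longrightarrow> U k (restrict_ext w y) = U n (restrict_ext w x))"
  using \<open>n \<le> k\<close>
proof (induction k rule: dec_induct)
  case base
  show ?case by (rule bexI[OF _ x]) simp
next
  case (step k)
  from step.IH obtain y where y: "y \<in> level m E k" "U k y = U n x"
    and yw: "\<forall>w. length w \<le> n \<longrightarrow> U k (restrict_ext w y) = U n (restrict_ext w x)"
    by (elim bexE conjE)
  show ?case
  proof (intro bexI[of _ "level_map m E k y"] conjI allI impI)
    show "level_map m E k y \<in> level m E (Suc k)" by (rule level_map_mem[OF y(1)])
    show "U (Suc k) (level_map m E k y) = U n x" unfolding U_level_map[OF y(1)] by (rule y(2))
    fix w :: "nat list" assume w: "length w \<le> n"
    then have k: "length w \<le> k" using step.hyps by simp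
    have "U (Suc k) (restrict_ext w (level_map m E k y)) = U k (restrict_ext w y)"
      unfolding restrict_ext_level_map[OF k] by (rule U_level_map[OF level_restrict_ext[OF y(1)]])
    also have "\<dots> = U n (restrict_ext w x)" using yw w by blast
    finally show "U (Suc k) (restrict_ext w (level_map m E k y)) = U n (restrict_ext w x)" .
  qed
qed

lemma U_lift2:
  assumes x: "x \<in> level m E i" "length w \<le> i" and y: "y \<in> level m E j" "length w \<le> j"
  obtains k x' y' where "length w \<le> k" "x' \<in> level m E k" "y' \<in> level m E k"
    "U k x' = U i x" "U k (restrict_ext w x') = U i (restrict_ext w x)"
    "U k y' = U j y" "U k (restrict_ext w y') = U j (restrict_ext w y)"
proof -
  obtain k where k: "i \<le> k" "j \<le> k" using max.cobounded1 max.cobounded2 by blast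
  from U_lift[OF x(1) k(1)] obtain x' where x': "x' \<in> level m E k" "U k x' = U i x"
    "\<forall>w. length w \<le> i \<longrightarrow> U k (restrict_ext w x') = U i (restrict_ext w x)"
    by (elim bexE conjE)
  from U_lift[OF y(1) k(2)] obtain y' where y': "y' \<in> level m E k" "U k y' = U j y"
    "\<forall>w. length w \<le> j \<longrightarrow> U k (restrict_ext w y') = U j (restrict_ext w y)"
    by (elim bexE conjE)
  have "length w \<le> k" using x(2) k(1) by simp
  then show thesis
    by (rule that[OF _ x'(1) y'(1) x'(2) x'(3)[rule_format, OF x(2)] y'(2) y'(3)[rule_format, OF y(2)]])
qed

lemma cylinder_projection_ex:
  obtains Q where "orth_projection Q"
    "\<And>n x. length w \<le> n \<Longrightarrow> x \<in> level m E n \<Longrightarrow> Q (U n x) = U n (restrict_ext w x)"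
proof -
  define G where "G = {(U n x, U n (restrict_ext w x)) | n x. length w \<le> n \<and> x \<in> level m E n}"
  have GI: "(U n x, U n (restrict_ext w x)) \<in> G" if "length w \<le> n" "x \<in> level m E n" for n x
    unfolding G_def using that by blast
  have GE: "\<exists>n x. length w \<le> n \<and> x \<in> level m E n \<and> a = U n x \<and> p = U n (restrict_ext w x)"
    if "(a, p) \<in> G" for a p
    using that unfolding G_def by blast
  have GE2: "\<exists>n x y. length w \<le> n \<and> x \<in> level m E n \<and> a = U n x \<and> p = U n (restrict_ext w x) \<and>
      y \<in> level m E n \<and> b = U n y \<and> q = U n (restrict_ext w y)"
    if "(a, p) \<in> G" "(b, q) \<in> G" for a p b q
  proof -
    from GE[OF that(1)] obtain i x where x: "length w \<le> i" "x \<in> level m E i"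
      and a: "a = U i x" "p = U i (restrict_ext w x)" by (elim exE conjE)
    from GE[OF that(2)] obtain j y where y: "length w \<le> j" "y \<in> level m E j"
      and b: "b = U j y" "q = U j (restrict_ext w y)" by (elim exE conjE)
    obtain k x' y' where 1: "length w \<le> k" "x' \<in> level m E k" "y' \<in> level m E k"
      and 2: "U k x' = U i x" "U k (restrict_ext w x') = U i (restrict_ext w x)"
        "U k y' = U j y" "U k (restrict_ext w y') = U j (restrict_ext w y)"
      by (rule U_lift2[OF x(2,1) y(2,1)])
    show ?thesis unfolding a b 2[symmetric]
      by (intro exI[of _ k] exI[of _ x'] exI[of _ y'] conjI 1 refl)
  qed
  show thesis
  proof (rule orth_projection_graph[of G])
    fix a p b q assume "(a, p) \<in> G" "(b, q) \<in> G"
    from GE2[OF this] obtain n x y where n: "length w \<le> n"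
      and x: "x \<in> level m E n" "a = U n x" "p = U n (restrict_ext w x)"
      and y: "y \<in> level m E n" "b = U n y" "q = U n (restrict_ext w y)" by (elim exE conjE)
    have "restrict_ext w (\<lambda>u. x u + y u) = (\<lambda>u. restrict_ext w x u + restrict_ext w y u)"
      by (auto simp: restrict_ext_def)
    then show "(a + b, p + q) \<in> G"
      using GI[OF n level_add[OF x(1) y(1)]]
      by (simp add: U_add[OF x(1) y(1)] U_add[OF level_restrict_ext[OF x(1)] level_restrict_ext[OF y(1)]] x y)
    show "inner p b = inner a q"
      unfolding x(2,3) y(2,3) U_inner[OF level_restrict_ext[OF x(1)] y(1)]
        U_inner[OF x(1) level_restrict_ext[OF y(1)]]
      by (rule sum.cong) (auto simp: restrict_ext_def)
  next
    fix a p assume "(a, p) \<in> G"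
    from GE[OF this] obtain n x where n: "length w \<le> n"
      and x: "x \<in> level m E n" "a = U n x" "p = U n (restrict_ext w x)" by (elim exE conjE)
    have "restrict_ext w (\<lambda>u. c *\<^sub>C x u) = (\<lambda>u. c *\<^sub>C restrict_ext w x u)" for c
      by (auto simp: restrict_ext_def)
    then show "(c *\<^sub>C a, c *\<^sub>C p) \<in> G" for c
      using GI[OF n level_scale[OF x(1), of c]]
      by (simp add: U_scale[OF x(1)] U_scale[OF level_restrict_ext[OF x(1)]] x)
    have "restrict_ext w (restrict_ext w x) = restrict_ext w x" by (auto simp: restrict_ext_def)
    then show "(p, p) \<in> G" using GI[OF n level_restrict_ext[OF x(1), of w]] by (simp add: x)
  next
    have "(\<Union>n. U n ` level m E n) \<subseteq> fst ` G"
    proof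
      fix a assume "a \<in> (\<Union>n. U n ` level m E n)"
      then obtain n x where x: "x \<in> level m E n" "a = U n x" by blast
      from U_lift[OF x(1) max.cobounded1[of n "length w"]]
      obtain y where y: "y \<in> level m E (max n (length w))" "U (max n (length w)) y = U n x"
        by (elim bexE conjE)
      have "(U (max n (length w)) y, U (max n (length w)) (restrict_ext w y)) \<in> G"
        by (rule GI) (simp_all add: y(1))
      then show "a \<in> fst ` G" unfolding x(2) y(2)[symmetric] by (rule image_eqI[rotated]) simp
    qed
    then show "closure (fst ` G) = UNIV" using closure_mono[of _ "fst ` G"] U_dense by (metis top.extremum_uniqueI)
  next
    fix Q assume Q: "orth_projection Q" "\<And>a p. (a, p) \<in> G \<Longrightarrow> Q a = p"
    show thesis by (rule that[OF Q(1) Q(2)[OF GI]])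
  qed
qed

text \<open>The images of the vectors \<open>root_vector n h\<close> are dense in the limit space.\<close>

definition limit_vector :: "nat \<Rightarrow> (nat list \<Rightarrow> 'h) \<Rightarrow> 'k"
  where "limit_vector n h = U n (root_vector n h)"

lemma inner_limit_vector: "inner (limit_vector n h) (limit_vector n h) = mass n h (space (Omega m))"
  unfolding limit_vector_def U_inner[OF root_vector_mem root_vector_mem] mass_space ..

lemma limit_vector_lift:
  assumes "n \<le> k"
  obtains g where "limit_vector k g = limit_vector n h" "\<And>A. A \<in> sets (Omega m) \<Longrightarrow> mass k g A = mass n h A"
proof -
  have "\<exists>g. limit_vector k g = limit_vector n h \<and> (\<forall>A\<in>sets (Omega m). mass k g A = mass n h A)"
    using assms
  proof (induction k rule: dec_induct)
    case base
    show ?case by blast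
  next
    case (step k)
    then obtain g where g: "limit_vector k g = limit_vector n h" "\<forall>A\<in>sets (Omega m). mass k g A = mass n h A" by blast
    have "limit_vector (Suc k) (\<lambda>u. g (butlast u)) = limit_vector k g"
      unfolding limit_vector_def level_map_root_vector[symmetric] by (rule U_level_map[OF root_vector_mem])
    with g show ?case by (intro exI[of _ "\<lambda>u. g (butlast u)"]) (simp add: mass_Suc)
  qed
  then show thesis using that by blast
qed

lemma limit_vector_dense: "closure {limit_vector n h | n h. True} = UNIV"
proof -
  have "U n x \<in> closure {limit_vector n h | n h. True}" if x: "x \<in> level m E n" for n x
  proof -
    have "\<forall>u\<in>words m n. \<exists>h. (\<lambda>k. S u (h k)) \<longlonglongrightarrow> x u"
    proof
      fix u assume "u \<in> words m n"
      then have "x u \<in> range_space m E u" using x by (simp add: level_def)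
      then obtain h where "(\<lambda>k. S u (h k)) \<longlonglongrightarrow> x u" by (rule range_space_approx)
      then show "\<exists>h. (\<lambda>k. S u (h k)) \<longlonglongrightarrow> x u" by (intro exI[of _ h])
    qed
    then obtain h where h: "\<And>u. u \<in> words m n \<Longrightarrow> (\<lambda>k. S u (h u k)) \<longlonglongrightarrow> x u" by metis
    define g where "g = (\<lambda>k u. h u k)"
    have "(\<lambda>k. \<Sum>u\<in>words m n. (norm (S u (g k u) - x u))\<^sup>2) \<longlonglongrightarrow> (\<Sum>u\<in>words m n. (norm (x u - x u))\<^sup>2)"
      unfolding g_def by (intro tendsto_sum tendsto_power tendsto_norm tendsto_diff h tendsto_const)
    moreover have "(norm (limit_vector n (g k) - U n x))\<^sup>2 = (\<Sum>u\<in>words m n. (norm (S u (g k u) - x u))\<^sup>2)" for k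
    proof -
      have "(norm (limit_vector n (g k) - U n x))\<^sup>2
          = (\<Sum>u\<in>words m n. inner (root_vector n (g k) u - x u) (root_vector n (g k) u - x u))"
        unfolding limit_vector_def U_diff[OF root_vector_mem x, symmetric] power2_norm_eq_inner
        by (rule U_inner) (rule level_diff[OF root_vector_mem x])+
      also have "\<dots> = (\<Sum>u\<in>words m n. (norm (S u (g k u) - x u))\<^sup>2)"
        unfolding power2_norm_eq_inner by (rule sum.cong) (simp_all add: root_vector_def)
      finally show ?thesis .
    qed
    ultimately have "(\<lambda>k. (norm (limit_vector n (g k) - U n x))\<^sup>2) \<longlonglongrightarrow> 0" by simp
    then have "(\<lambda>k. sqrt ((norm (limit_vector n (g k) - U n x))\<^sup>2)) \<longlonglongrightarrow> sqrt 0" by (rule tendsto_real_sqrt)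
    then have "(\<lambda>k. limit_vector n (g k)) \<longlonglongrightarrow> U n x"
      by (simp add: tendsto_norm_zero_iff LIM_zero_iff)
    then show ?thesis unfolding closure_sequential
      by (intro exI[of _ "\<lambda>k. limit_vector n (g k)"] conjI allI) blast
  qed
  then have "closure (\<Union>n. U n ` level m E n) \<subseteq> closure {limit_vector n h | n h. True}"
    by (intro closure_minimal) auto
  then show ?thesis unfolding U_dense by (rule top.extremum_uniqueI)
qed

text \<open>An inequality between continuous functions holds everywhere if it holds at these vectors.\<close>

lemma limit_vector_le_by_density:
  assumes "\<And>n h. f (limit_vector n h) \<le> (g (limit_vector n h) :: real)" "continuous_on UNIV f" "continuous_on UNIV g"
  shows "f x \<le> g x"
proof -
  have "closed {x. f x \<le> g x}" by (intro closed_Collect_le assms)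
  moreover have "{limit_vector n h | n h. True} \<subseteq> {x. f x \<le> g x}" using assms(1) by auto
  ultimately have "closure {limit_vector n h | n h. True} \<subseteq> {x. f x \<le> g x}" by (intro closure_minimal)
  then show ?thesis unfolding limit_vector_dense by auto
qed

text \<open>The condition that characterizes the value \<open>Q\<close> on \<open>A\<close> of the measure to be constructed: its
  quadratic form on the dense set of vectors \<open>limit_vector n h\<close> is prescribed by \<open>E\<close>.\<close>

definition represents :: "(nat \<Rightarrow> nat) set \<Rightarrow> ('k \<Rightarrow> 'k) \<Rightarrow> bool"
  where "represents A Q \<longleftrightarrow>
    orth_projection Q \<and> (\<forall>n h. inner (limit_vector n h) (Q (limit_vector n h)) = mass n h A)"

lemma represents_unique:
  assumes "represents A Q" "represents A R"
  shows "Q = R"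
proof (rule symmetric_op_eqI[OF _ _ _ _ limit_vector_dense])
  show "bounded_clinear Q" "symmetric_op Q" "bounded_clinear R" "symmetric_op R"
    using assms by (auto simp: represents_def orth_projection_iff)
  show "inner x (Q x) = inner x (R x)" if "x \<in> {limit_vector n h | n h. True}" for x
    using that assms by (auto simp: represents_def)
qed

lemma represents_space: "represents (space (Omega m)) (\<lambda>x. x)"
  by (simp add: represents_def inner_limit_vector orth_projection_iff bounded_clinear_id symmetric_op_def)

lemma represents_compl:
  assumes A: "A \<in> sets (Omega m)" and Q: "represents A Q"
  shows "represents (space (Omega m) - A) (\<lambda>x. x - Q x)"
  unfolding represents_def orth_projection_iff
proof (intro conjI allI)
  have oQ: "orth_projection Q" using Q by (simp add: represents_def)
  note lin = orth_projection_bounded_clinear[OF oQ]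
  show "bounded_clinear (\<lambda>x. x - Q x)" by (intro bounded_clinear_subtract bounded_clinear_id lin)
  show "symmetric_op (\<lambda>x. x - Q x)"
    using orth_projection_symmetric[OF oQ] by (simp add: symmetric_op_def inner_diff_left inner_diff_right)
  show "x - Q x - Q (x - Q x) = x - Q x" for x
    by (simp add: bounded_clinear_diff[OF lin] orth_projection_idem[OF oQ])
  fix n h
  have "mass n h (A \<union> (space (Omega m) - A)) = mass n h A + mass n h (space (Omega m) - A)"
    using A by (intro mass_Un) auto
  moreover have "A \<union> (space (Omega m) - A) = space (Omega m)" using sets.sets_into_space[OF A] by blast
  moreover have "inner (limit_vector n h) (Q (limit_vector n h)) = mass n h A" using Q by (simp add: represents_def)
  ultimately show "inner (limit_vector n h) (limit_vector n h - Q (limit_vector n h)) = mass n h (space (Omega m) - A)"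
    by (simp add: inner_diff_right inner_limit_vector)
qed

lemma represents_empty: "represents {} (\<lambda>x. 0)"
  using represents_compl[OF sets.top represents_space] by simp

lemma represents_UN:
  assumes A: "range A \<subseteq> sets (Omega m)" "disjoint_family A" and Q: "\<And>i. represents (A i) (Q i)"
  obtains T where "represents (\<Union>i. A i) T" "\<And>x. (\<lambda>i. Q i x) sums T x"
proof (rule orth_projection_series[of Q])
  have Q_form: "inner (limit_vector n h) (Q i (limit_vector n h)) = mass n h (A i)" for i n h
    using Q[of i] by (simp add: represents_def)
  show oQ: "orth_projection (Q i)" for i using Q by (simp add: represents_def)
  show "(\<Sum>i<n. inner x (Q i x)) \<le> inner x x" for n x
  proof (rule limit_vector_le_by_density[where f = "\<lambda>x. \<Sum>i<n. inner x (Q i x)"])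
    fix k h
    have "(\<Sum>i<n. mass k h (A i)) \<le> (\<Sum>i. mass k h (A i))"
      using A(1) by (intro sum_le_suminf sums_summable[OF mass_sums[OF A]] mass_nonneg) auto
    also have "\<dots> = mass k h (\<Union>i. A i)" by (rule sums_unique[OF mass_sums[OF A], symmetric])
    also have "\<dots> \<le> mass k h (\<Union>i. A i) + mass k h (space (Omega m) - (\<Union>i. A i))"
      using A(1) by (simp add: mass_nonneg sets.compl_sets sets.countable_UN)
    also have "\<dots> = mass k h ((\<Union>i. A i) \<union> (space (Omega m) - (\<Union>i. A i)))"
      using A(1) by (intro mass_Un[symmetric] sets.compl_sets sets.countable_UN) auto
    also have "(\<Union>i. A i) \<union> (space (Omega m) - (\<Union>i. A i)) = space (Omega m)"
      using A(1) sets.sets_into_space by blast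
    finally show "(\<Sum>i<n. inner (limit_vector k h) (Q i (limit_vector k h))) \<le> inner (limit_vector k h) (limit_vector k h)"
      by (simp add: Q_form inner_limit_vector)
  next
    have "continuous_on UNIV (Q i)" for i
      using orth_projection_bounded_clinear[OF oQ] bounded_clinear_linear linear_continuous_on by blast
    then show "continuous_on UNIV (\<lambda>x. \<Sum>i<n. inner x (Q i x))"
      by (intro continuous_intros)
    show "continuous_on UNIV (\<lambda>x::'k. inner x x)" by (intro continuous_intros)
  qed
  fix T assume T: "orth_projection T" "\<And>x. (\<lambda>i. Q i x) sums T x"
  have "represents (\<Union>i. A i) T" unfolding represents_def
  proof (intro conjI allI T)
    fix n h
    have "(\<lambda>i. inner (limit_vector n h) (Q i (limit_vector n h))) sums inner (limit_vector n h) (T (limit_vector n h))"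
      by (rule bounded_linear.sums[OF bounded_linear_inner_right T(2)])
    then show "inner (limit_vector n h) (T (limit_vector n h)) = mass n h (\<Union>i. A i)"
      using mass_sums[OF A, of n h] by (simp add: Q_form sums_unique2)
  qed
  then show thesis using T(2) by (rule that)
qed

text \<open>A vector of a level below \<open>length w\<close> is lifted first; then each cylinder set of the level is
  contained in \<open>cyl m w\<close> or disjoint from it.\<close>

lemma represents_cyl:
  assumes oQ: "orth_projection Q"
    and Q: "\<And>n x. length w \<le> n \<Longrightarrow> x \<in> level m E n \<Longrightarrow> Q (U n x) = U n (restrict_ext w x)"
  shows "represents (cyl m w) Q"
  unfolding represents_def
proof (intro conjI allI oQ)
  fix n h
  obtain g where g: "limit_vector (max n (length w)) g = limit_vector n h"
    "\<And>A. A \<in> sets (Omega m) \<Longrightarrow> mass (max n (length w)) g A = mass n h A"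
    by (rule limit_vector_lift[of n "max n (length w)"]) auto
  define k where "k = max n (length w)"
  have "inner (S u (g u)) (restrict_ext w (root_vector k g) u) = inner (g u) (E (cyl m w \<inter> cyl m u) (g u))"
    if u: "u \<in> words m k" for u
  proof (cases "prefix w u")
    case True
    then have "cyl m w \<inter> cyl m u = cyl m u" using cyl_mono by blast
    with True u show ?thesis by (simp add: restrict_ext_def root_vector_def inner_S)
  next
    case False
    have "length w \<le> length u" using u by (simp add: k_def words_iff)
    then have "\<not> prefix u w" using False by (auto simp: prefix_def)
    with False have "cyl m w \<inter> cyl m u = {}" by (intro cyl_disjoint)
    with False show ?thesis by (simp add: restrict_ext_def povm_empty[OF povm])
  qed
  then have "inner (U k (root_vector k g)) (U k (restrict_ext w (root_vector k g))) = mass k g (cyl m w)"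
    unfolding U_inner[OF root_vector_mem level_restrict_ext[OF root_vector_mem]] mass_def
    by (intro sum.cong refl) (simp add: root_vector_def)
  moreover have "Q (limit_vector k g) = U k (restrict_ext w (root_vector k g))"
    unfolding limit_vector_def by (rule Q[OF _ root_vector_mem]) (simp add: k_def)
  ultimately have "inner (limit_vector k g) (Q (limit_vector k g)) = mass k g (cyl m w)" by (simp add: limit_vector_def)
  then show "inner (limit_vector n h) (Q (limit_vector n h)) = mass n h (cyl m w)"
    using g(1) g(2)[OF sets_cyl] by (simp add: k_def)
qed

lemma represents_ex:
  assumes A: "A \<in> sets (Omega m)"
  shows "\<exists>Q. represents A Q"
proof -
  from A have A': "A \<in> sigma_sets (space (Omega m)) (cylinders m)" by (simp add: sets_Omega)
  show ?thesis
    using Int_stable_cylinders cylinders_subset_Pow A'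
  proof (induction rule: sigma_sets_induct_disjoint)
    case (basic A)
    have "\<exists>Q. represents (cyl m w) Q" for w
      using cylinder_projection_ex[of w] represents_cyl by metis
    then show ?case using basic represents_empty by (auto simp: cylinders_def)
  next
    case empty
    show ?case using represents_empty by blast
  next
    case (compl A)
    then show ?case using represents_compl by (auto simp: sets_Omega)
  next
    case (union A)
    then have "range A \<subseteq> sets (Omega m)" by (simp add: sets_Omega)
    moreover obtain Q where "\<And>i. represents (A i) (Q i)" using union(3) by metis
    ultimately show ?case using represents_UN[OF _ union(1)] by metis
  qed
qed

text \<open>The projection-valued measure; it is \<open>undefined\<close> outside the measurable sets, which makes it
  unique as a HOL function.\<close>

definition dilation :: "(nat \<Rightarrow> nat) set \<Rightarrow> 'k \<Rightarrow> 'k"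
  where "dilation = (\<lambda>A\<in>sets (Omega m). SOME Q. represents A Q)"

lemma dilation_extensional: "dilation \<in> extensional (sets (Omega m))"
  by (simp add: dilation_def)

lemma represents_dilation: "A \<in> sets (Omega m) \<Longrightarrow> represents A (dilation A)"
  using someI_ex[OF represents_ex] by (simp add: dilation_def)

lemma dilation_eqI: "A \<in> sets (Omega m) \<Longrightarrow> represents A Q \<Longrightarrow> dilation A = Q"
  using represents_dilation represents_unique by blast

lemma orth_projection_dilation: "A \<in> sets (Omega m) \<Longrightarrow> orth_projection (dilation A)"
  using represents_dilation by (simp add: represents_def)

lemma dilation_cyl_U:
  assumes "length w \<le> n" "x \<in> level m E n"
  shows "dilation (cyl m w) (U n x) = U n (restrict_ext w x)"
proof -
  obtain Q where Q: "orth_projection Q"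
    "\<And>n x. length w \<le> n \<Longrightarrow> x \<in> level m E n \<Longrightarrow> Q (U n x) = U n (restrict_ext w x)"
    using cylinder_projection_ex[of w] by metis
  have "dilation (cyl m w) = Q" by (rule dilation_eqI[OF sets_cyl represents_cyl[OF Q]])
  then show ?thesis using Q(2)[OF assms] by simp
qed

lemma pvm_dilation: "pvm m dilation"
  unfolding pvm_def povm_def
proof (intro conjI ballI allI impI)
  show "orth_projection (dilation A)" "positive_op (dilation A)" if "A \<in> sets (Omega m)" for A
    using orth_projection_dilation[OF that] orth_projection_positive by blast+
  show "dilation (space (Omega m)) = id"
    using dilation_eqI[OF sets.top represents_space] by (simp add: id_def)
  fix A :: "nat \<Rightarrow> (nat \<Rightarrow> nat) set" and x y
  assume A: "range A \<subseteq> sets (Omega m)" "disjoint_family A"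
  have rep: "represents (A i) (dilation (A i))" for i
    using A(1) by (intro represents_dilation) auto
  obtain T where T: "represents (\<Union>i. A i) T" "\<And>x. (\<lambda>i. dilation (A i) x) sums T x"
    using represents_UN[OF A rep] by blast
  have "dilation (\<Union>i. A i) = T"
    using A(1) by (intro dilation_eqI T(1) sets.countable_UN)
  then have "(\<lambda>i. inner x (dilation (A i) y)) sums inner x (dilation (\<Union>i. A i) y)" for x
    using bounded_linear.sums[OF bounded_linear_inner_right T(2)] by simp
  then show "(\<lambda>i. cinner x (dilation (A i) y)) sums cinner x (dilation (\<Union>i. A i) y)"
    by (rule sums_cinnerI)
qed

end

theorem theorem3p3:
  fixes m :: nat
    and E :: "(nat \<Rightarrow> nat) set \<Rightarrow> 'h::chilbert_space \<Rightarrow> 'h"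
    and U :: "nat \<Rightarrow> (nat list \<Rightarrow> 'h) \<Rightarrow> 'k::chilbert_space"
  assumes "m \<ge> 2"
    and "povm m E"
    and "direct_limit m E U"
  shows "(\<forall>w \<in> lists {..<m}. \<forall>n \<ge> length w. \<forall>x \<in> level m E n.
           level_proj m E (Suc n) w (level_map m E n x) = level_map m E n (level_proj m E n w x)) \<and>
         (\<exists>Pw :: nat list \<Rightarrow> 'k \<Rightarrow> 'k.
           (\<forall>w \<in> lists {..<m}. orth_projection (Pw w) \<and>
             (\<forall>n \<ge> length w. \<forall>x \<in> level m E n. Pw w (U n x) = U n (level_proj m E n w x))) \<and>
           (\<exists>!P. P \<in> extensional (sets (Omega m)) \<and> pvm m P \<and>
             (\<forall>w \<in> lists {..<m}. P (cyl m w) = Pw w)))"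
proof -
  interpret povm_limit m E U
    by unfold_locales fact+
  show ?thesis
  proof (intro conjI exI[of _ "\<lambda>w. dilation (cyl m w)"] ballI allI impI)
    fix w n x assume "w \<in> lists {..<m}" and n: "length w \<le> n" and x: "x \<in> level m E n"
    show "level_proj m E (Suc n) w (level_map m E n x) = level_map m E n (level_proj m E n w x)"
      by (simp add: level_proj_eq[OF x] level_proj_eq[OF level_map_mem[OF x]] restrict_ext_level_map[OF n])
    show "dilation (cyl m w) (U n x) = U n (level_proj m E n w x)"
      by (simp add: level_proj_eq[OF x] dilation_cyl_U[OF n x])
  next
    show "orth_projection (dilation (cyl m w))" for w
      by (rule orth_projection_dilation[OF sets_cyl])
    show "\<exists>!P. P \<in> extensional (sets (Omega m)) \<and> pvm m P \<and>
        (\<forall>w \<in> lists {..<m}. P (cyl m w) = dilation (cyl m w))"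
    proof (rule ex1I[of _ dilation])
      show "dilation \<in> extensional (sets (Omega m)) \<and> pvm m dilation \<and>
          (\<forall>w \<in> lists {..<m}. dilation (cyl m w) = dilation (cyl m w))"
        using dilation_extensional pvm_dilation by blast
      fix P assume P: "P \<in> extensional (sets (Omega m)) \<and> pvm m P \<and>
          (\<forall>w \<in> lists {..<m}. P (cyl m w) = dilation (cyl m w))"
      show "P = dilation"
      proof (rule extensionalityI)
        show "P \<in> extensional (sets (Omega m))" using P by blast
        show "dilation \<in> extensional (sets (Omega m))" by (rule dilation_extensional)
        show "P A = dilation A" if "A \<in> sets (Omega m)" for A
          using P pvm_dilation that by (intro povm_eqI[of m P dilation A]) (auto simp: pvm_def)
      qed
    qed
  qed
qed

end
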